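(* Let $z_1=z_{1x}+i z_{1y}$ and $z_2=z_{2x}+iz_{2y}$ be complex numbers with positive imaginary parts satisfying the gluing equations of the figure-eight knot complement $M$ (see context), and let $\rho_u:\pi_1(M)\to \mathrm{PSL}(2,\mathbb{C})$ be the associated holonomy representation. Write $$k_x=z_{1x}-z_{1x}z_{2x}+z_{1y}z_{2y},\qquad k_y=z_{1y}-z_{1y}z_{2x}-z_{1x}z_{2y},$$ $$c_x=z_{1x}z_{2x}+z_{1y}z_{2y}-z_{1x}|z_2|^2,\qquad c_y=-z_{1x}z_{2y}+z_{1y}z_{2x}-z_{1y}|z_2|^2,\qquad K=|z_1(1-z_2)|^2 .$$ Then, under the isometry $g$ from the upper half space model to the Klein model of hyperbolic $3$-space, the isometries $\rho_u(x)$ and $\rho_u(y)$ are represented in $\mathrm{PSO}(3,1)\subset \mathrm{PGL}(4,\mathbb{R})$, up to scale, by $$x\mapsto\begin{pmatrix} 8k_x & 8k_y & -4k_x & -4k_x\\ -8k_y & 8k_x & 4k_y & 4k_y\\ 4&0&3+4K&-5+4K\\ -4&0&-3+4K&5+4K\end{pmatrix},$$ $$y\mapsto\begin{pmatrix} 2k_x & -2k_y & 4c_x & -4c_x\\ 2k_y&2k_x&4c_y&-4c_y\\ -4z_{2x}&4z_{2y}&1-4|z_2|^2+K&1+4|z_2|^2-K\\ -4z_{2x}&4z_{2y}&1-4|z_2|^2-K&1+4|z_2|^2+K\end{pmatrix}.$$ In particular this gives a family of representations $\pi_1(M)\to\mathrm{PSO}(3,1)$, deforming the discrete and faithful one, whose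 generators have matrix entries that are rational functions of the real and imaginary parts of $z_1$ and $z_2$.
   Context: $\pi_1(M)=\langle x,y\mid ax=ya\rangle$ with $a=xy^{-1}x^{-1}y$. The gluing equations are $$2\,\mathrm{Log}\, z_1+\mathrm{Log}\tfrac1{1-z_1}+\mathrm{Log}\, z_2+2\,\mathrm{Log}\left(1-\tfrac1{z_2}\right)=2\pi i,$$ $$\mathrm{Log}\tfrac1{1-z_1}+2\,\mathrm{Log}\left(1-\tfrac1{z_1}\right)+\mathrm{Log}\, z_2+2\,\mathrm{Log}\tfrac1{1-z_2}=2\pi i .$$ The complete structure corresponds to $z_1=z_2=e^{\pi i/3}$. The holonomy representation is $$\rho_u(x)=\begin{pmatrix}\frac1{\sqrt{z_1(1-z_2)}}&-\frac1{\sqrt{z_1(1-z_2)}}\\0&\sqrt{z_1(1-z_2)}\end{pmatrix},\qquad \rho_u(y)=\begin{pmatrix}\sqrt{z_1(1-z_2)}&0\\-\frac{z_2}{\sqrt{z_1(1-z_2)}}&\frac1{\sqrt{z_1(1-z_2)}}\end{pmatrix},$$ where $u=\mathrm{Log}(z_1(1-z_2))$, acting by Möbius transformations on $\partial H^3=\hat{\mathbb{C}}$. The Klein model $K^3\subset\mathbb{R}P^3$ is the projectivization of $\{x_1^2+x_2^2+x_3^2-x_4^2<0\}$, and $(X,Y,Z)\in\mathbb{R}^3$ denotes $[X:Y:Z:1]$. The isometry $g:H^3\to K^3$ from the upper half space model, extended to boundaries, is $$g(X,Y,Z)=\left(\tfrac{4X}{4+r},\tfrac{4Y}{4+r},\tfrac{4-r}{4+r}\right),\quad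 r=X^2+Y^2+Z^2,\qquad g(\infty)=(0,0,-1),$$ with $X+iY\in\mathbb{C}\subset\partial H^3$ identified with $(X,Y,0)$. $\mathrm{PSO}(3,1)$ is the group of projective transformations given by the isometries of $K^3$ preserving the Lorentz form up to scale. *)

theory Defs
  imports "HOL-Analysis.Analysis" "HOL-Algebra.Coset"
begin

section \<open>Groups given by generators and relations\<close>

text \<open>A letter \<open>(s, True)\<close> is the generator \<open>s\<close>, a letter \<open>(s, False)\<close> is its formal inverse.\<close>

type_synonym 'g word = "('g \<times> bool) list"

inductive word_eq :: "('g word \<times> 'g word) set \<Rightarrow> 'g word \<Rightarrow> 'g word \<Rightarrow> bool"
  for R :: "('g word \<times> 'g word) set" where
  refl: "word_eq R w w"
| sym: "word_eq R v w \<Longrightarrow> word_eq R w v"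
| trans: "word_eq R u v \<Longrightarrow> word_eq R v w \<Longrightarrow> word_eq R u w"
| append: "word_eq R u u' \<Longrightarrow> word_eq R v v' \<Longrightarrow> word_eq R (u @ v) (u' @ v')"
| cancel: "word_eq R [(s, b), (s, \<not> b)] []"
| relation: "(u, v) \<in> R \<Longrightarrow> word_eq R u v"

definition word_class :: "('g word \<times> 'g word) set \<Rightarrow> 'g word \<Rightarrow> 'g word set" where
  "word_class R w = {v. word_eq R w v}"

definition presented_group :: "('g word \<times> 'g word) set \<Rightarrow> 'g word set monoid" where
  "presented_group R =
    \<lparr>carrier = range (word_class R),
     mult = (\<lambda>A B. {w. \<exists>u\<in>A. \<exists>v\<in>B. word_eq R (u @ v) w}),
     one = word_class R []\<rparr>"

definition eval_word :: "('a, 'c) monoid_scheme \<Rightarrow> ('g \<Rightarrow> 'a) \<Rightarrow> 'g word \<Rightarrow> 'a" where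
  "eval_word G f w =
    foldr (\<lambda>(s, b) a. (if b then f s else inv\<^bsub>G\<^esub> (f s)) \<otimes>\<^bsub>G\<^esub> a) w \<one>\<^bsub>G\<^esub>"

text \<open>The map on classes of words determined by images of the generators.  It does not depend on
  the chosen word, and is a homomorphism, exactly when the images satisfy the relations.\<close>

definition induced_map :: "('a, 'c) monoid_scheme \<Rightarrow> ('g \<Rightarrow> 'a) \<Rightarrow> 'g word set \<Rightarrow> 'a" where
  "induced_map G f C = eval_word G f (SOME w. w \<in> C)"

lemma word_class_eq_iff: "word_class R v = word_class R w \<longleftrightarrow> word_eq R v w"
  unfolding word_class_def by (auto intro: word_eq.intros)

lemma presented_group_mult:
  "word_class R u \<otimes>\<^bsub>presented_group R\<^esub> word_class R v = word_class R (u @ v)"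
  unfolding word_class_def presented_group_def
  by (auto intro: word_eq.intros)

lemma word_eq_inverse: "\<exists>v. word_eq R (v @ w) []"
proof (induction w)
  case Nil
  show ?case using word_eq.refl[of R "[]"] by (intro exI[of _ "[]"]) simp
next
  case (Cons l w)
  obtain s b where l: "l = (s, b)" by fastforce
  obtain v where v: "word_eq R (v @ w) []" using Cons by blast
  have "word_eq R ([(s, \<not> b), l] @ w) ([] @ w)"
    using word_eq.cancel[of R s "\<not> b"] word_eq.refl l by (intro word_eq.append) auto
  then have "word_eq R (v @ [(s, \<not> b), l] @ w) (v @ w)"
    using word_eq.append[OF word_eq.refl[of R v]] by simp
  then have "word_eq R ((v @ [(s, \<not> b)]) @ l # w) []"
    using v word_eq.trans by fastforce
  then show ?case by blast
qed

lemma group_presented_group: "group (presented_group R)"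
proof (rule groupI)
  show "\<one>\<^bsub>presented_group R\<^esub> \<in> carrier (presented_group R)"
    by (simp add: presented_group_def)
  fix x assume "x \<in> carrier (presented_group R)"
  then obtain u where x: "x = word_class R u" by (auto simp: presented_group_def)
  show "\<one>\<^bsub>presented_group R\<^esub> \<otimes>\<^bsub>presented_group R\<^esub> x = x"
    using presented_group_mult[of R "[]" u] x by (simp add: presented_group_def)
  obtain v where "word_eq R (v @ u) []" using word_eq_inverse by blast
  then have "word_class R v \<otimes>\<^bsub>presented_group R\<^esub> x = \<one>\<^bsub>presented_group R\<^esub>"
    unfolding x presented_group_mult word_class_eq_iff[symmetric] by (simp add: presented_group_def)
  then show "\<exists>y\<in>carrier (presented_group R). y \<otimes>\<^bsub>presented_group R\<^esub> x = \<one>\<^bsub>presented_group R\<^esub>"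
    by (auto simp: presented_group_def)
  fix y assume "y \<in> carrier (presented_group R)"
  then obtain v where y: "y = word_class R v" by (auto simp: presented_group_def)
  show "x \<otimes>\<^bsub>presented_group R\<^esub> y \<in> carrier (presented_group R)"
    unfolding x y presented_group_mult by (simp add: presented_group_def)
  fix z assume "z \<in> carrier (presented_group R)"
  then obtain w where z: "z = word_class R w" by (auto simp: presented_group_def)
  show "x \<otimes>\<^bsub>presented_group R\<^esub> y \<otimes>\<^bsub>presented_group R\<^esub> z =
      x \<otimes>\<^bsub>presented_group R\<^esub> (y \<otimes>\<^bsub>presented_group R\<^esub> z)"
    unfolding x y z presented_group_mult by simp
qed


section \<open>The figure-eight knot group\<close>

datatype generator = GX | GY

definition word_a :: "generator word" where
  "word_a = [(GX, True), (GY, False), (GX, False), (GY, True)]"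

definition fig8_relations :: "(generator word \<times> generator word) set" where
  "fig8_relations = {(word_a @ [(GX, True)], [(GY, True)] @ word_a)}"

definition fig8_group :: "generator word set monoid" where
  "fig8_group = presented_group fig8_relations"

definition fig8_gen :: "generator \<Rightarrow> generator word set" where
  "fig8_gen s = word_class fig8_relations [(s, True)]"


section \<open>The groups PSL(2,C), PGL(4,R) and PSO(3,1)\<close>

definition SL2C :: "(complex^2^2) monoid" where
  "SL2C = \<lparr>carrier = {A. det A = 1}, mult = (**), one = mat 1\<rparr>"

definition PSL2C :: "(complex^2^2) set monoid" where
  "PSL2C = SL2C Mod {mat 1, mat (-1)}"

definition psl_class :: "complex^2^2 \<Rightarrow> (complex^2^2) set" where
  "psl_class A = {mat 1, mat (-1)} #>\<^bsub>SL2C\<^esub> A"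

definition GL4R :: "(real^4^4) monoid" where
  "GL4R = \<lparr>carrier = {A. invertible A}, mult = (**), one = mat 1\<rparr>"

definition scalars4 :: "(real^4^4) set" where
  "scalars4 = {mat c |c. c \<noteq> 0}"

definition PGL4R :: "(real^4^4) set monoid" where
  "PGL4R = GL4R Mod scalars4"

definition pgl_class :: "real^4^4 \<Rightarrow> (real^4^4) set" where
  "pgl_class A = scalars4 #>\<^bsub>GL4R\<^esub> A"

definition lorentz :: "real^4^4" where
  "lorentz = (\<chi> i j. if i = j then (if i = 4 then -1 else 1) else 0)"

text \<open>Matrices preserving the Lorentz form up to scale.  The factor \<open>c\<close> of an invertible such
  matrix is automatically positive, by the law of inertia.  In even dimension the sign of the
  determinant does not change under scaling; positive determinant singles out the image of
  SO(3,1), that is, the orientation preserving isometries.\<close>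

definition PSO31 :: "(real^4^4) set monoid" where
  "PSO31 = PGL4R\<lparr>carrier :=
    {P \<in> carrier PGL4R. \<forall>A\<in>P. (\<exists>c. transpose A ** lorentz ** A = c *\<^sub>R lorentz) \<and> det A > 0}\<rparr>"

text \<open>The quotient topology: the preimage in GL(4,R) of a set of classes is its union, and
  GL(4,R) is open in the space of all matrices.\<close>

definition PGL4R_topology :: "(real^4^4) set topology" where
  "PGL4R_topology = topology (\<lambda>U. U \<subseteq> carrier PGL4R \<and> open (\<Union>U))"

definition discrete_in_PGL4R :: "(real^4^4) set set \<Rightarrow> bool" where
  "discrete_in_PGL4R H \<longleftrightarrow> subtopology PGL4R_topology H = discrete_topology H"

lemma group_SL2C: "group SL2C"
proof (rule groupI)
  fix A assume "A \<in> carrier SL2C"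
  then have d: "det A = 1" by (simp add: SL2C_def)
  then obtain B where B: "B ** A = mat 1"
    by (metis invertible_det_nz invertible_def zero_neq_one)
  then have "det B * det A = 1" by (metis det_I det_mul)
  then show "\<exists>B\<in>carrier SL2C. B \<otimes>\<^bsub>SL2C\<^esub> A = \<one>\<^bsub>SL2C\<^esub>"
    using B d by (auto simp: SL2C_def)
qed (auto simp: SL2C_def det_mul matrix_mul_assoc)

lemma group_GL4R: "group GL4R"
proof (rule groupI)
  fix A assume "A \<in> carrier GL4R"
  then obtain B where "A ** B = mat 1" "B ** A = mat 1"
    by (auto simp: GL4R_def invertible_def)
  then show "\<exists>B\<in>carrier GL4R. B \<otimes>\<^bsub>GL4R\<^esub> A = \<one>\<^bsub>GL4R\<^esub>"
    by (auto simp: GL4R_def invertible_def)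
qed (auto simp: GL4R_def invertible_det_nz det_mul matrix_mul_assoc)

lemma mat_mult_left: "mat c ** (A :: 'a::comm_semiring_1^'n^'n) = (\<chi> i j. c * A $ i $ j)"
  by (simp add: matrix_matrix_mult_def mat_def vec_eq_iff if_distrib if_distribR cong: if_cong)

lemma mat_mult_right: "(A :: 'a::comm_semiring_1^'n^'n) ** mat c = (\<chi> i j. c * A $ i $ j)"
  by (simp add: matrix_matrix_mult_def mat_def vec_eq_iff if_distrib if_distribR mult.commute
      cong: if_cong)

lemma normal_center_SL2C: "{mat 1, mat (-1)} \<lhd> SL2C"
proof -
  have sq: "mat (-1) ** mat (-1) = (mat 1 :: complex^2^2)"
    unfolding mat_mult_left by (simp add: mat_def vec_eq_iff)
  have dt: "det (mat (-1) :: complex^2^2) = 1" by (simp add: det_2 mat_def)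
  have "subgroup {mat 1, mat (-1)} SL2C"
  proof (rule group.subgroupI[OF group_SL2C])
    fix a :: "complex^2^2" assume a: "a \<in> {mat 1, mat (-1)}"
    have "inv\<^bsub>SL2C\<^esub> a = a"
      by (rule group.inv_equality[OF group_SL2C]) (use a sq dt in \<open>auto simp: SL2C_def\<close>)
    then show "inv\<^bsub>SL2C\<^esub> a \<in> {mat 1, mat (-1)}" using a by simp
  qed (use sq dt in \<open>auto simp: SL2C_def\<close>)
  then show ?thesis
    by (rule group.normalI[OF group_SL2C])
      (auto simp: r_coset_def l_coset_def SL2C_def mat_mult_left mat_mult_right)
qed

lemma group_PSL2C: "group PSL2C"
  unfolding PSL2C_def by (rule normal.factorgroup_is_group[OF normal_center_SL2C])

lemma mat_mult_mat: "mat c ** mat d = (mat (c * d) :: 'a::comm_semiring_1^'n^'n)"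
  unfolding mat_mult_left by (simp add: mat_def vec_eq_iff)

lemma normal_scalars4: "scalars4 \<lhd> GL4R"
proof -
  have inv_mat: "mat c ** mat (inverse c) = (mat 1 :: real^4^4)" if "c \<noteq> 0" for c
    using that by (simp add: mat_mult_mat)
  have invertible: "invertible (mat c :: real^4^4)" if "c \<noteq> 0" for c
    unfolding invertible_def using that by (intro exI[of _ "mat (inverse c)"]) (simp add: mat_mult_mat)
  have "subgroup scalars4 GL4R"
  proof (rule group.subgroupI[OF group_GL4R])
    fix a assume "a \<in> scalars4"
    then obtain c where c: "a = mat c" "c \<noteq> 0" by (auto simp: scalars4_def)
    have "inv\<^bsub>GL4R\<^esub> a = mat (inverse c)"
      by (rule group.inv_equality[OF group_GL4R])
        (use c invertible in \<open>auto simp: GL4R_def mat_mult_mat\<close>)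
    then show "inv\<^bsub>GL4R\<^esub> a \<in> scalars4" using c by (auto simp: scalars4_def)
  next
    fix a b assume "a \<in> scalars4" "b \<in> scalars4"
    then show "a \<otimes>\<^bsub>GL4R\<^esub> b \<in> scalars4"
      by (auto simp: scalars4_def GL4R_def mat_mult_mat)
  qed (auto simp: scalars4_def GL4R_def invertible intro: exI[of _ 1])
  then show ?thesis
    by (rule group.normalI[OF group_GL4R])
      (auto simp: r_coset_def l_coset_def GL4R_def scalars4_def mat_mult_left mat_mult_right)
qed

lemma group_PGL4R: "group PGL4R"
  unfolding PGL4R_def by (rule normal.factorgroup_is_group[OF normal_scalars4])

lemma scaleR_mm_left: "(c *\<^sub>R A) ** B = c *\<^sub>R (A ** B)" for A B :: "real^'n^'n"
  by (simp add: matrix_matrix_mult_def vec_eq_iff sum_distrib_left mult.assoc)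

lemma scaleR_mm_right: "A ** (c *\<^sub>R B) = c *\<^sub>R (A ** B)" for A B :: "real^'n^'n"
  by (simp add: matrix_matrix_mult_def vec_eq_iff sum_distrib_left algebra_simps)

lemma mem_pgl_class: "B \<in> pgl_class A \<longleftrightarrow> (\<exists>c. c \<noteq> 0 \<and> B = c *\<^sub>R A)"
proof -
  have "mat c ** A = c *\<^sub>R A" for c by (simp add: mat_mult_left vec_eq_iff)
  then show ?thesis by (auto simp: pgl_class_def r_coset_def GL4R_def scalars4_def)
qed

lemma carrier_PGL4R: "carrier PGL4R = pgl_class ` {A. invertible A}"
  by (simp add: PGL4R_def carrier_FactGroup pgl_class_def[abs_def] GL4R_def)

lemma pgl_class_in_PSO31:
  assumes "invertible A"
  shows "pgl_class A \<in> carrier PSO31 \<longleftrightarrow>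
    (\<exists>c. transpose A ** lorentz ** A = c *\<^sub>R lorentz) \<and> det A > 0" (is "?L \<longleftrightarrow> ?R")
proof
  assume ?L
  moreover have "A \<in> pgl_class A" unfolding mem_pgl_class by (intro exI[of _ 1]) simp
  ultimately show ?R by (auto simp: PSO31_def)
next
  assume R: ?R
  then obtain c where c: "transpose A ** lorentz ** A = c *\<^sub>R lorentz" by blast
  have "transpose (k *\<^sub>R A) ** lorentz ** (k *\<^sub>R A) = (k * k * c) *\<^sub>R lorentz" for k
  proof -
    have "transpose (k *\<^sub>R A) = k *\<^sub>R transpose A" by (simp add: transpose_def vec_eq_iff)
    then have "transpose (k *\<^sub>R A) ** lorentz ** (k *\<^sub>R A) = (k * k) *\<^sub>R (transpose A ** lorentz ** A)"
      by (simp add: scaleR_mm_left scaleR_mm_right)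
    then show ?thesis using c by simp
  qed
  moreover have "det (k *\<^sub>R A) > 0" if "k \<noteq> 0" for k
  proof -
    have "k *\<^sub>R A = mat k ** A" by (simp add: mat_mult_left vec_eq_iff)
    then have "det (k *\<^sub>R A) = k ^ 4 * det A" by (simp add: det_mul det_diagonal mat_def)
    moreover have "k ^ 4 > 0" using that by simp
    ultimately show ?thesis using R by simp
  qed
  ultimately show ?L
    using assms by (auto simp: PSO31_def carrier_PGL4R mem_pgl_class)
qed

lemma group_PSO31: "group PSO31"
proof -
  interpret N: normal scalars4 GL4R by (rule normal_scalars4)
  let ?J = "lorentz"
  have cls_mult: "pgl_class A \<otimes>\<^bsub>PGL4R\<^esub> pgl_class B = pgl_class (A ** B)"
    if "invertible A" "invertible B" for A B
    using N.rcos_sum[of A B] that by (simp add: PGL4R_def pgl_class_def GL4R_def)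
  have one: "\<one>\<^bsub>PGL4R\<^esub> = pgl_class (mat 1)"
    using N.coset_mult_one[OF N.subset] by (simp add: PGL4R_def pgl_class_def GL4R_def)
  have car: "\<exists>A. invertible A \<and> P = pgl_class A \<and> det A > 0 \<and>
      (\<exists>c. transpose A ** ?J ** A = c *\<^sub>R ?J)" if "P \<in> carrier PSO31" for P
  proof -
    have "P \<in> carrier PGL4R" using that by (simp add: PSO31_def)
    then show ?thesis using that pgl_class_in_PSO31 by (auto simp: carrier_PGL4R)
  qed
  have J: "?J \<noteq> 0" by (auto simp: lorentz_def vec_eq_iff)
  have sub: "subgroup (carrier PSO31) PGL4R"
  proof (rule group.subgroupI[OF group_PGL4R])
    show "carrier PSO31 \<subseteq> carrier PGL4R" by (auto simp: PSO31_def)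
    have "pgl_class (mat 1) \<in> carrier PSO31"
      by (subst pgl_class_in_PSO31)
        (auto simp: invertible_det_nz transpose_mat intro: exI[of _ 1])
    then show "carrier PSO31 \<noteq> {}" by blast
  next
    fix P assume P: "P \<in> carrier PSO31"
    obtain A c where A: "invertible A" "P = pgl_class A" "det A > 0"
      "transpose A ** ?J ** A = c *\<^sub>R ?J" using car[OF P] by blast
    obtain B where B: "A ** B = mat 1" "B ** A = mat 1" using A(1) by (auto simp: invertible_def)
    have tB: "transpose B ** transpose A = mat 1"
      using B(1) by (metis matrix_transpose_mul transpose_mat)
    have iB: "invertible B" using B by (auto simp: invertible_def)
    have "det A * det B = 1" using B(1) by (metis det_I det_mul)
    then have dB: "det B > 0" using A(3) by (metis zero_less_mult_pos zero_less_one)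
    have "?J = transpose B ** (transpose A ** ?J ** A) ** B"
      by (metis B(1) tB matrix_mul_assoc matrix_mul_lid matrix_mul_rid)
    then have *: "?J = c *\<^sub>R (transpose B ** ?J ** B)"
      unfolding A(4) by (simp add: scaleR_mm_left scaleR_mm_right)
    then have "c \<noteq> 0" using J by auto
    then have "transpose B ** ?J ** B = inverse c *\<^sub>R ?J"
      by (subst (2) *) simp
    then have "pgl_class B \<in> carrier PSO31" using dB pgl_class_in_PSO31[OF iB] by blast
    moreover have "inv\<^bsub>PGL4R\<^esub> P = pgl_class B"
    proof (rule group.inv_equality[OF group_PGL4R])
      show "pgl_class B \<otimes>\<^bsub>PGL4R\<^esub> P = \<one>\<^bsub>PGL4R\<^esub>" using A B iB by (simp add: cls_mult one)
    qed (use A iB in \<open>auto simp: carrier_PGL4R\<close>)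
    ultimately show "inv\<^bsub>PGL4R\<^esub> P \<in> carrier PSO31" by simp
  next
    fix P Q assume P: "P \<in> carrier PSO31" and Q: "Q \<in> carrier PSO31"
    obtain A c where A: "invertible A" "P = pgl_class A" "det A > 0"
      "transpose A ** ?J ** A = c *\<^sub>R ?J" using car[OF P] by blast
    obtain B d where B: "invertible B" "Q = pgl_class B" "det B > 0"
      "transpose B ** ?J ** B = d *\<^sub>R ?J" using car[OF Q] by blast
    have "transpose (A ** B) ** ?J ** (A ** B) = transpose B ** (transpose A ** ?J ** A) ** B"
      by (simp add: matrix_transpose_mul matrix_mul_assoc)
    also have "\<dots> = (c * d) *\<^sub>R ?J"
      unfolding A(4) using B(4) by (simp add: scaleR_mm_left scaleR_mm_right)
    finally have "pgl_class (A ** B) \<in> carrier PSO31"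
      using pgl_class_in_PSO31[OF invertible_mult[OF A(1) B(1)]] A(3) B(3) by (auto simp: det_mul)
    then show "P \<otimes>\<^bsub>PGL4R\<^esub> Q \<in> carrier PSO31" using A B by (simp add: cls_mult)
  qed
  have "PSO31 = PGL4R\<lparr>carrier := carrier PSO31\<rparr>" by (simp add: PSO31_def)
  then show ?thesis using group.subgroup_imp_group[OF group_PGL4R sub] by metis
qed

lemma istopology_PGL4R: "istopology (\<lambda>U. U \<subseteq> carrier PGL4R \<and> open (\<Union>U))"
  unfolding istopology_def
proof (intro conjI allI impI; (elim conjE)?)
  fix S T assume S: "S \<subseteq> carrier PGL4R" "open (\<Union>S)" and T: "T \<subseteq> carrier PGL4R" "open (\<Union>T)"
  show "S \<inter> T \<subseteq> carrier PGL4R" using S by blast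
  have rc: "carrier PGL4R = rcosets\<^bsub>GL4R\<^esub> scalars4" by (simp add: PGL4R_def FactGroup_def)
  have "P = Q" if "P \<in> S" "Q \<in> T" "A \<in> P" "A \<in> Q" for P Q A
    using group.rcos_disjoint[OF group_GL4R normal_imp_subgroup[OF normal_scalars4]]
      S(1) T(1) that unfolding rc pairwise_def disjnt_def by blast
  then have "\<Union>(S \<inter> T) = \<Union>S \<inter> \<Union>T" by blast
  then show "open (\<Union>(S \<inter> T))" using S T by (simp add: open_Int)
next
  fix \<K> assume K: "\<forall>U\<in>\<K>. U \<subseteq> carrier PGL4R \<and> open (\<Union>U)"
  then show "\<Union>\<K> \<subseteq> carrier PGL4R" by blast
  have "\<Union>(\<Union>\<K>) = (\<Union>U\<in>\<K>. \<Union>U)" by blast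
  then show "open (\<Union>(\<Union>\<K>))" using K by auto
qed

lemma openin_PGL4R: "openin PGL4R_topology U \<longleftrightarrow> U \<subseteq> carrier PGL4R \<and> open (\<Union>U)"
  unfolding PGL4R_topology_def topology_inverse'[OF istopology_PGL4R] ..


section \<open>The isometry from the upper half space to the Klein model\<close>

text \<open>The boundary is \<open>\<complex> \<union> {\<infinity>}\<close>, with \<open>None\<close> as the point at infinity; a point
  \<open>(X, Y, Z)\<close> of the upper half space is \<open>(X + iY, Z)\<close> with \<open>Z > 0\<close>.\<close>

definition moebius :: "complex^2^2 \<Rightarrow> complex option \<Rightarrow> complex option" where
  "moebius A p =
    (case p of
       None \<Rightarrow> if A$2$1 = 0 then None else Some (A$1$1 / A$2$1)
     | Some w \<Rightarrow> if A$2$1 * w + A$2$2 = 0 then None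
                 else Some ((A$1$1 * w + A$1$2) / (A$2$1 * w + A$2$2)))"

text \<open>The Poincare extension of a Moebius transformation with matrix of determinant one.\<close>

definition upper_action :: "complex^2^2 \<Rightarrow> complex \<times> real \<Rightarrow> complex \<times> real" where
  "upper_action A p =
    (let w = fst p; t = snd p;
         a = A$1$1; b = A$1$2; c = A$2$1; d = A$2$2;
         D = (cmod (c * w + d))\<^sup>2 + (cmod c)\<^sup>2 * t\<^sup>2
     in (((a * w + b) * cnj (c * w + d) + a * cnj c * of_real (t\<^sup>2)) / of_real D, t / D))"

definition g_map :: "complex \<times> real \<Rightarrow> real^3" where
  "g_map p =
    (let x = Re (fst p); y = Im (fst p); z = snd p; r = x\<^sup>2 + y\<^sup>2 + z\<^sup>2
     in vector [4 * x / (4 + r), 4 * y / (4 + r), (4 - r) / (4 + r)])"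

definition g_boundary :: "complex option \<Rightarrow> real^3" where
  "g_boundary p = (case p of None \<Rightarrow> vector [0, 0, -1] | Some w \<Rightarrow> g_map (w, 0))"

definition homogeneous :: "real^3 \<Rightarrow> real^4" where
  "homogeneous v = vector [v$1, v$2, v$3, 1]"

definition same_point :: "real^4 \<Rightarrow> real^4 \<Rightarrow> bool" where
  "same_point u v \<longleftrightarrow> (\<exists>c. c \<noteq> 0 \<and> u = c *\<^sub>R v)"

text \<open>The projective transformation \<open>P\<close> of the Klein model is the \<open>g\<close>-conjugate of the isometry
  \<open>C\<close> of the upper half space, both inside and on the boundary.\<close>

definition represents :: "(real^4^4) set \<Rightarrow> (complex^2^2) set \<Rightarrow> bool" where
  "represents P C \<longleftrightarrow>
    (\<forall>M\<in>P. \<forall>A\<in>C.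
       (\<forall>w t. t > 0 \<longrightarrow>
          same_point (M *v homogeneous (g_map (w, t))) (homogeneous (g_map (upper_action A (w, t))))) \<and>
       (\<forall>p. same_point (M *v homogeneous (g_boundary p)) (homogeneous (g_boundary (moebius A p)))))"


section \<open>The gluing equations and the representations\<close>

definition gluing_equations :: "complex \<Rightarrow> complex \<Rightarrow> bool" where
  "gluing_equations z1 z2 \<longleftrightarrow>
     2 * Ln z1 + Ln (1 / (1 - z1)) + Ln z2 + 2 * Ln (1 - 1 / z2) = 2 * of_real pi * \<i> \<and>
     Ln (1 / (1 - z1)) + 2 * Ln (1 - 1 / z1) + Ln z2 + 2 * Ln (1 / (1 - z2)) = 2 * of_real pi * \<i>"

definition gluing_solutions :: "(complex \<times> complex) set" where
  "gluing_solutions = {(z1, z2). Im z1 > 0 \<and> Im z2 > 0 \<and> gluing_equations z1 z2}"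

definition complete_point :: "complex \<times> complex" where
  "complete_point = (exp (of_real pi * \<i> / 3), exp (of_real pi * \<i> / 3))"

definition rho_matrix :: "complex \<Rightarrow> complex \<Rightarrow> generator \<Rightarrow> complex^2^2" where
  "rho_matrix z1 z2 s =
    (let q = csqrt (z1 * (1 - z2)) in
     case s of
       GX \<Rightarrow> vector [vector [1 / q, - (1 / q)], vector [0, q]]
     | GY \<Rightarrow> vector [vector [q, 0], vector [- (z2 / q), 1 / q]])"

definition holonomy :: "complex \<Rightarrow> complex \<Rightarrow> generator word set \<Rightarrow> (complex^2^2) set" where
  "holonomy z1 z2 = induced_map PSL2C (\<lambda>s. psl_class (rho_matrix z1 z2 s))"

definition klein_matrix :: "complex \<Rightarrow> complex \<Rightarrow> generator \<Rightarrow> real^4^4" where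
  "klein_matrix z1 z2 s =
    (let z1x = Re z1; z1y = Im z1; z2x = Re z2; z2y = Im z2;
         kx = z1x - z1x * z2x + z1y * z2y;
         ky = z1y - z1y * z2x - z1x * z2y;
         N = (cmod z2)\<^sup>2;
         cx = z1x * z2x + z1y * z2y - z1x * N;
         cy = - (z1x * z2y) + z1y * z2x - z1y * N;
         K = (cmod (z1 * (1 - z2)))\<^sup>2
     in case s of
       GX \<Rightarrow> vector
         [vector [8 * kx, 8 * ky, - 4 * kx, - 4 * kx],
          vector [- 8 * ky, 8 * kx, 4 * ky, 4 * ky],
          vector [4, 0, 3 + 4 * K, - 5 + 4 * K],
          vector [- 4, 0, - 3 + 4 * K, 5 + 4 * K]]
     | GY \<Rightarrow> vector
         [vector [2 * kx, - 2 * ky, 4 * cx, - 4 * cx],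
          vector [2 * ky, 2 * kx, 4 * cy, - 4 * cy],
          vector [- 4 * z2x, 4 * z2y, 1 - 4 * N + K, 1 + 4 * N - K],
          vector [- 4 * z2x, 4 * z2y, 1 - 4 * N - K, 1 + 4 * N + K]])"

definition klein_holonomy :: "complex \<Rightarrow> complex \<Rightarrow> generator word set \<Rightarrow> (real^4^4) set" where
  "klein_holonomy z1 z2 = induced_map PGL4R (\<lambda>s. pgl_class (klein_matrix z1 z2 s))"

text \<open>Every real polynomial function on \<open>\<complex> \<times> \<complex>\<close> is a polynomial in the four real and
  imaginary parts, because these are a basis of the linear functionals.\<close>

definition rational_function_on ::
    "(complex \<times> complex) set \<Rightarrow> (complex \<times> complex \<Rightarrow> real) \<Rightarrow> bool" where
  "rational_function_on D f \<longleftrightarrow>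
    (\<exists>p q. real_polynomial_function p \<and> real_polynomial_function q \<and>
       (\<forall>z\<in>D. q z \<noteq> 0 \<and> f z = p z / q z))"

end

theory Submission
  imports Defs "HOL-Algebra.Generated_Groups"
begin

text \<open>Both parametrisations of isometries act on one object: a point of the upper half space, or of its
boundary, is a ray of positive semidefinite Hermitian \<open>2 \<times> 2\<close> matrices, on which \<open>A\<close> acts by
\<open>E \<mapsto> A E A\<^sup>*\<close>.  Reading a Hermitian matrix in suitable real coordinates turns minus its determinant
into the Lorentz form and turns the isometry \<open>g\<close> into the passage to homogeneous coordinates.  This
gives a homomorphism \<open>lorentz_rep\<close> from SL(2,C) to the Lorentz group that intertwines the two actions
(\<open>represents_lorentz_rep\<close>), and the two \<open>4 \<times> 4\<close> matrices of the theorem are positive multiples of the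
images of \<open>\<rho>(x)\<close> and \<open>\<rho>(y)\<close> (\<open>klein_matrix_lorentz_rep\<close>).  Exponentiating a gluing equation leaves
\<open>(z\<^sub>1(1 - z\<^sub>2))\<^sup>2 = z\<^sub>2(1 - z\<^sub>1)\<close>, which is exactly what the relation \<open>a x = y a\<close> needs in SL(2,C)
(\<open>rho_matrix_relation\<close>).  Everything about a fixed solution is thus transported from a
representation into SL(2,C).

Near the complete solution the curve above is a quadratic equation for \<open>z\<^sub>1\<close>, so a branch of the
square root parametrises an arc; the logarithmic equations persist along it, since their left hand
sides move continuously in a discrete set (\<open>exists_arc\<close>).

The substantial point is that the complete holonomy is faithful.  It permutes the tetrahedra of the
tessellation of hyperbolic space by regular ideal tetrahedra.  Form the graph whose vertices are the
pairs of a group element \<open>g\<close> and one of the two tetrahedra of the figure-eight knot complement, and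
whose edges cross a face; a pair stands for the image of the tetrahedron under \<open>\<rho>(g)\<close>.  Give each
vertex the height \<open>\<Sum> f(v)\<close>, where \<open>v\<close> runs over integral vectors representing the four ideal
vertices and \<open>f\<close> is the Hermitian form of the centre of the base tetrahedron.  Six tetrahedra
surround each edge of the tessellation, and on them the height is a constant plus a sampled cosine:
if two neighbours of a tetrahedron across faces with a common edge are both lower, then the heights
keep falling both ways around the edge, down to the tetrahedron opposite (\<open>turn_descends\<close>).  The cycle of six closes up already in the
abstract group, by the knot relation (\<open>turn_meets\<close>).  Heights of adjacent tetrahedra never agree, as
they differ modulo 3.  So descent is a terminating, locally confluent rewriting relation, and by
Newman's lemma the connected graph has only one local minimum.  If \<open>\<rho>(g)\<close> is trivial then the base
tetrahedron paired with \<open>1\<close> and with \<open>g\<close> gives two local minima, hence \<open>g = 1\<close> (\<open>figure_eight.faithful\<close>).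

Discreteness is arithmetic: in a suitable basis the complete holonomy consists of integral matrices
of determinant one, and products of two entries divided by the square root of the determinant are
well-defined continuous functions on PGL(4,R) (\<open>discrete_in_PGL4R_criterion\<close>).\<close>


section \<open>Homomorphisms out of a presented group\<close>

lemma eval_word_Nil [simp]: "eval_word K f [] = \<one>\<^bsub>K\<^esub>"
  by (simp add: eval_word_def)

lemma eval_word_Cons [simp]:
  "eval_word K f ((s, b) # w) = (if b then f s else inv\<^bsub>K\<^esub> (f s)) \<otimes>\<^bsub>K\<^esub> eval_word K f w"
  by (simp add: eval_word_def)

lemma eval_word_closed:
  assumes "group K" "\<And>s. f s \<in> carrier K"
  shows "eval_word K f w \<in> carrier K"
proof -
  interpret K: group K by fact
  show ?thesis by (induction w) (auto simp: assms(2))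
qed

lemma eval_word_append:
  assumes "group K" "\<And>s. f s \<in> carrier K"
  shows "eval_word K f (u @ v) = eval_word K f u \<otimes>\<^bsub>K\<^esub> eval_word K f v"
proof -
  interpret K: group K by fact
  show ?thesis
    by (induction u) (auto simp: assms(2) eval_word_closed[OF assms] K.m_assoc)
qed

text \<open>The universal property of a presentation: evaluation respects each rule that generates \<open>word_eq\<close>
as soon as it respects the relations.\<close>

lemma word_eq_imp_eval_word_eq:
  assumes K: "group K" "\<And>s. f s \<in> carrier K"
    and rel: "\<And>u v. (u, v) \<in> R \<Longrightarrow> eval_word K f u = eval_word K f v"
    and "word_eq R u v"
  shows "eval_word K f u = eval_word K f v"
proof -
  interpret K: group K by fact
  show ?thesis using assms(4)
    by induction (auto simp: rel eval_word_append[OF K] K(2))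
qed

lemma induced_map_word_class:
  assumes K: "group K" "\<And>s. f s \<in> carrier K"
    and rel: "\<And>u v. (u, v) \<in> R \<Longrightarrow> eval_word K f u = eval_word K f v"
  shows "induced_map K f (word_class R w) = eval_word K f w"
proof -
  have "w \<in> word_class R w" by (simp add: word_class_def word_eq.refl)
  then have "(SOME v. v \<in> word_class R w) \<in> word_class R w" by (rule someI)
  then have "word_eq R w (SOME v. v \<in> word_class R w)" by (simp add: word_class_def)
  then show ?thesis
    unfolding induced_map_def using word_eq_imp_eval_word_eq[OF K rel] by metis
qed

lemma induced_map_hom:
  assumes K: "group K" "\<And>s. f s \<in> carrier K"
    and rel: "\<And>u v. (u, v) \<in> R \<Longrightarrow> eval_word K f u = eval_word K f v"
  shows "induced_map K f \<in> hom (presented_group R) K"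
proof (rule homI)
  fix P Q assume "P \<in> carrier (presented_group R)" "Q \<in> carrier (presented_group R)"
  then obtain u v where "P = word_class R u" "Q = word_class R v"
    by (auto simp: presented_group_def)
  then show "induced_map K f (P \<otimes>\<^bsub>presented_group R\<^esub> Q) =
      induced_map K f P \<otimes>\<^bsub>K\<^esub> induced_map K f Q"
    by (simp add: presented_group_mult induced_map_word_class[OF K rel] eval_word_append[OF K])
qed (auto simp: presented_group_def induced_map_word_class[OF K rel] eval_word_closed[OF K])

lemma hom_eval_word:
  assumes K: "group K" "\<And>s. f s \<in> carrier K" and L: "group L" and h: "h \<in> hom K L"
  shows "h (eval_word K f w) = eval_word L (\<lambda>s. h (f s)) w"
proof -
  interpret group_hom K L h by (simp add: group_hom_def group_hom_axioms_def K L h)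
  show ?thesis by (induction w) (auto simp: K(2) eval_word_closed[OF K])
qed

text \<open>Evaluating in the presented group itself makes facts about its elements available as facts about
words, without choosing representatives.\<close>

lemma eval_word_presented_group:
  "eval_word (presented_group R) (\<lambda>s. word_class R [(s, True)]) w = word_class R w"
proof (induction w)
  case Nil
  show ?case by (simp add: presented_group_def)
next
  case (Cons l w)
  obtain s b where l: "l = (s, b)" by fastforce
  interpret P: group "presented_group R" by (rule group_presented_group)
  have mem: "word_class R u \<in> carrier (presented_group R)" for u
    by (simp add: presented_group_def)
  have "word_class R [(s, False)] \<otimes>\<^bsub>presented_group R\<^esub> word_class R [(s, True)] = \<one>\<^bsub>presented_group R\<^esub>"
    using word_eq.cancel[of R s False]
    by (simp add: presented_group_mult) (simp add: presented_group_def word_class_eq_iff)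
  then have "inv\<^bsub>presented_group R\<^esub> word_class R [(s, True)] = word_class R [(s, False)]"
    by (rule P.inv_equality) (simp_all add: mem)
  then show ?case
    by (simp add: l Cons presented_group_mult)
qed


section \<open>Hermitian matrices as Lorentz vectors\<close>

lemma vector_4 [simp]:
  "(vector [a, b, c, d] :: 'a::zero^4) $ 1 = a" "(vector [a, b, c, d] :: 'a::zero^4) $ 2 = b"
  "(vector [a, b, c, d] :: 'a::zero^4) $ 3 = c" "(vector [a, b, c, d] :: 'a::zero^4) $ 4 = d"
  unfolding vector_def by simp_all

lemma mat2_mult [simp]:
  "(A ** B) $ 1 $ 1 = A $ 1 $ 1 * B $ 1 $ 1 + A $ 1 $ 2 * B $ 2 $ 1"
  "(A ** B) $ 1 $ 2 = A $ 1 $ 1 * B $ 1 $ 2 + A $ 1 $ 2 * B $ 2 $ 2"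
  "(A ** B) $ 2 $ 1 = A $ 2 $ 1 * B $ 1 $ 1 + A $ 2 $ 2 * B $ 2 $ 1"
  "(A ** B) $ 2 $ 2 = A $ 2 $ 1 * B $ 1 $ 2 + A $ 2 $ 2 * B $ 2 $ 2"
  for A B :: "'a::comm_semiring_1^2^2"
  by (simp_all add: matrix_matrix_mult_def sum_2)

definition ctrans :: "complex^2^2 \<Rightarrow> complex^2^2" where
  "ctrans A = (\<chi> i j. cnj (A $ j $ i))"

lemma ctrans_nth [simp]: "ctrans A $ i $ j = cnj (A $ j $ i)"
  by (simp add: ctrans_def)

lemma ctrans_mult: "ctrans (A ** B) = ctrans B ** ctrans A"
  by (simp add: vec_eq_iff forall_2 mult.commute)

lemma ctrans_ctrans [simp]: "ctrans (ctrans A) = A"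
  by (simp add: vec_eq_iff)

text \<open>The coordinates are fixed by \<open>g\<close>: the point \<open>w + tj\<close> of the upper half space corresponds to the
Hermitian matrix with rows \<open>(\<bar>w\<bar>\<^sup>2 + t\<^sup>2, w)\<close> and \<open>(cnj w, 1)\<close>, and the homogeneous coordinates of its
image under \<open>g\<close> are proportional to \<open>(4 Re w, 4 Im w, 4 - r, 4 + r)\<close> with \<open>r = \<bar>w\<bar>\<^sup>2 + t\<^sup>2\<close>.\<close>

definition herm :: "real^4 \<Rightarrow> complex^2^2" where
  "herm v = vector [vector [of_real ((v$4 - v$3) / 2), Complex (v$1 / 4) (v$2 / 4)],
     vector [Complex (v$1 / 4) (- v$2 / 4), of_real ((v$4 + v$3) / 8)]]"

definition klein :: "complex^2^2 \<Rightarrow> real^4" where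
  "klein E = vector [4 * Re (E$1$2), 4 * Im (E$1$2), 4 * Re (E$2$2) - Re (E$1$1), 4 * Re (E$2$2) + Re (E$1$1)]"

lemma klein_herm [simp]: "klein (herm v) = v"
  by (simp add: klein_def herm_def vec_eq_iff forall_4 field_simps)

lemma herm_klein:
  assumes "ctrans E = E" shows "herm (klein E) = E"
proof -
  have *: "cnj (E$1$1) = E$1$1" "cnj (E$2$2) = E$2$2" "E$2$1 = cnj (E$1$2)"
    using assms by (auto simp: vec_eq_iff)
  have "Im (E$1$1) = 0" "Im (E$2$2) = 0" using *(1,2) by (simp_all add: complex_eq_iff)
  then show ?thesis using *(3)
    by (simp add: klein_def herm_def vec_eq_iff forall_2 complex_eq_iff field_simps)
qed

lemma ctrans_herm [simp]: "ctrans (herm v) = herm v"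
  by (simp add: vec_eq_iff forall_2 herm_def complex_eq_iff)

lemma klein_add: "klein (E + F) = klein E + klein F"
  by (simp add: klein_def vec_eq_iff forall_4)

lemma klein_scale: "klein (mat (of_real c) ** E) = c *\<^sub>R klein E"
  by (simp add: mat_mult_left klein_def vec_eq_iff forall_4 algebra_simps del: mat2_mult)

lemma linear_klein_congruence: "linear (\<lambda>v. klein (A ** herm v ** ctrans A))"
proof (rule linearI)
  fix u v :: "real^4" and c :: real
  have "herm (u + v) = herm u + herm v"
    by (simp add: herm_def vec_eq_iff forall_2 complex_eq_iff add_divide_distrib diff_divide_distrib)
  then have "A ** herm (u + v) ** ctrans A = A ** herm u ** ctrans A + A ** herm v ** ctrans A"
    by (simp add: vec_eq_iff forall_2 algebra_simps)
  then show "klein (A ** herm (u + v) ** ctrans A) =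
      klein (A ** herm u ** ctrans A) + klein (A ** herm v ** ctrans A)"
    by (simp only: klein_add)
  have "herm (c *\<^sub>R v) = mat (of_real c) ** herm v"
    by (simp add: mat_mult_left herm_def vec_eq_iff forall_2 complex_eq_iff algebra_simps)
  then have "A ** herm (c *\<^sub>R v) ** ctrans A = mat (of_real c) ** (A ** herm v ** ctrans A)"
    by (simp add: mat_mult_left vec_eq_iff forall_2 algebra_simps)
  then show "klein (A ** herm (c *\<^sub>R v) ** ctrans A) = c *\<^sub>R klein (A ** herm v ** ctrans A)"
    by (simp only: klein_scale)
qed

definition lorentz_rep :: "complex^2^2 \<Rightarrow> real^4^4" where
  "lorentz_rep A = matrix (\<lambda>v. klein (A ** herm v ** ctrans A))"

lemma lorentz_rep_apply: "lorentz_rep A *v v = klein (A ** herm v ** ctrans A)"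
  unfolding lorentz_rep_def by (rule matrix_works[OF linear_klein_congruence[folded linear_matrix_vector_mul_eq]])

lemma lorentz_rep_klein:
  assumes "ctrans E = E" shows "lorentz_rep A *v klein E = klein (A ** E ** ctrans A)"
  by (simp add: lorentz_rep_apply herm_klein[OF assms])

lemma lorentz_rep_mult: "lorentz_rep (A ** B) = lorentz_rep A ** lorentz_rep B"
proof -
  have "lorentz_rep A *v (lorentz_rep B *v v) = lorentz_rep (A ** B) *v v" for v
    by (simp add: lorentz_rep_apply herm_klein ctrans_mult matrix_mul_assoc)
  then show ?thesis by (simp add: matrix_eq matrix_vector_mul_assoc)
qed

lemma lorentz_rep_one [simp]: "lorentz_rep (mat 1) = mat 1"
proof -
  have "ctrans (mat 1) = mat 1" by (simp add: vec_eq_iff mat_def)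
  then have "lorentz_rep (mat 1) *v v = mat 1 *v v" for v by (simp add: lorentz_rep_apply)
  then show ?thesis using matrix_eq by blast
qed

lemma lorentz_rep_uminus [simp]: "lorentz_rep (- A) = lorentz_rep A"
proof -
  have "(- A) ** E ** ctrans (- A) = A ** E ** ctrans A" for E
    by (simp add: vec_eq_iff forall_2 algebra_simps)
  then show ?thesis by (simp add: lorentz_rep_def)
qed

lemma invertible_lorentz_rep:
  assumes "det A = 1" shows "invertible (lorentz_rep A)"
proof -
  obtain B where "A ** B = mat 1" "B ** A = mat 1"
    using assms by (metis invertible_det_nz invertible_def zero_neq_one)
  then show ?thesis unfolding invertible_def by (metis lorentz_rep_mult lorentz_rep_one)
qed

lemma det_ctrans: "det (ctrans A) = cnj (det A)"
  by (simp add: det_2)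

lemma lorentz_form: "v \<bullet> (lorentz *v v) = - 16 * Re (det (herm v))"
  by (simp add: lorentz_def inner_vec_def matrix_vector_mult_def sum_4 det_2 herm_def field_simps)

text \<open>The quadratic form is \<open>-16 det\<close>, which congruence by a matrix of determinant one preserves; the
bilinear form follows by polarisation.\<close>

lemma lorentz_rep_isometry:
  assumes "det A = 1"
  shows "transpose (lorentz_rep A) ** lorentz ** lorentz_rep A = lorentz"
proof -
  define q where "q v = v \<bullet> (lorentz *v v)" for v
  let ?M = "lorentz_rep A"
  have q: "q (?M *v v) = q v" for v
  proof -
    have "det (herm (?M *v v)) = det (herm v)"
      by (simp add: lorentz_rep_apply herm_klein ctrans_mult matrix_mul_assoc det_mul det_ctrans assms)
    then show ?thesis by (simp add: q_def lorentz_form)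
  qed
  have polar: "2 * (u \<bullet> (lorentz *v v)) = q (u + v) - q u - q v" for u v
    by (simp add: q_def lorentz_def inner_vec_def matrix_vector_mult_def sum_4 algebra_simps)
  have "2 * ((?M *v u) \<bullet> (lorentz *v (?M *v v))) = 2 * (u \<bullet> (lorentz *v v))" for u v
    unfolding polar by (simp flip: matrix_vector_right_distrib add: q)
  moreover have "u \<bullet> ((transpose ?M ** lorentz ** ?M) *v v) = (?M *v u) \<bullet> (lorentz *v (?M *v v))" for u v
    by (simp add: inner_commute[of u] dot_lmul_matrix inner_commute[of "?M *v u"] flip: matrix_vector_mul_assoc)
  ultimately have "u \<bullet> ((transpose ?M ** lorentz ** ?M) *v v) = u \<bullet> (lorentz *v v)" for u v
    by simp
  then show ?thesis by (metis matrix_eq vector_eq_ldot)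
qed

text \<open>By Cayley and Hamilton \<open>(A + 1)\<^sup>2 = (tr A + 2) A\<close>, so \<open>(A + 1) / \<surd>(tr A + 2)\<close> is a square root of \<open>A\<close>
unless \<open>tr A = -2\<close>, in which case \<open>-A\<close> has trace \<open>2\<close>.\<close>

lemma SL2_square_or_minus_square:
  fixes A :: "complex^2^2"
  assumes "det A = 1"
  shows "\<exists>B. det B = 1 \<and> (B ** B = A \<or> B ** B = - A)"
proof -
  have *: "\<exists>B. det B = 1 \<and> B ** B = A" if dA: "det A = 1" and tr: "A$1$1 + A$2$2 + 2 \<noteq> 0" for A :: "complex^2^2"
  proof -
    define r where "r = csqrt (A$1$1 + A$2$2 + 2)"
    have r2: "r * r = A$1$1 + A$2$2 + 2" by (simp add: r_def flip: power2_eq_square)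
    then have r: "r \<noteq> 0" using tr by auto
    define B :: "complex^2^2" where "B = (\<chi> i j. (A$i$j + (if i = j then 1 else 0)) / r)"
    have d: "A$1$1 * A$2$2 - A$1$2 * A$2$1 = 1" using dA by (simp add: det_2)
    have "(A$1$1 + 1) * (A$2$2 + 1) - A$1$2 * A$2$1 = r * r"
      "(A$1$1 + 1) * (A$1$1 + 1) + A$1$2 * A$2$1 = A$1$1 * (r * r)"
      "(A$1$1 + 1) * A$1$2 + A$1$2 * (A$2$2 + 1) = A$1$2 * (r * r)"
      "A$2$1 * (A$1$1 + 1) + (A$2$2 + 1) * A$2$1 = A$2$1 * (r * r)"
      "A$2$1 * A$1$2 + (A$2$2 + 1) * (A$2$2 + 1) = A$2$2 * (r * r)"
      using d r2 by algebra+
    then have "det B = 1" "B ** B = A"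
      using r by (simp_all add: B_def det_2 vec_eq_iff forall_2 flip: add_divide_distrib diff_divide_distrib)
    then show ?thesis by blast
  qed
  show ?thesis
  proof (cases "A$1$1 + A$2$2 + 2 = 0")
    case False
    then show ?thesis using *[OF assms] by blast
  next
    case True
    have "det (- A) = 1" using assms by (simp add: det_2)
    moreover have "(- A)$1$1 + (- A)$2$2 + 2 \<noteq> 0"
      using True by (auto simp: add_eq_0_iff)
    ultimately show ?thesis using *[of "- A"] by blast
  qed
qed

text \<open>Preserving the Lorentz form leaves only the sign of the determinant open, and the image of a square
has positive determinant.\<close>

lemma det_lorentz_rep:
  assumes "det A = 1" shows "det (lorentz_rep A) = 1"
proof -
  obtain B where B: "det B = 1" "B ** B = A \<or> B ** B = - A"
    using SL2_square_or_minus_square[OF assms] by blast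
  have "lorentz_rep A = lorentz_rep B ** lorentz_rep B"
    using B(2) by (metis lorentz_rep_mult lorentz_rep_uminus)
  then have "det (lorentz_rep A) = (det (lorentz_rep B))\<^sup>2" by (simp add: det_mul power2_eq_square)
  moreover have "(det (lorentz_rep B))\<^sup>2 = 1"
  proof -
    have "det lorentz = -1"
    proof -
      have "det lorentz = (\<Prod>i\<in>(UNIV :: 4 set). lorentz $ i $ i)"
        by (rule det_diagonal) (simp add: lorentz_def)
      also have "\<dots> = (\<Prod>i\<in>(UNIV :: 4 set). if i = 4 then - 1 else 1)" by (simp add: lorentz_def)
      also have "\<dots> = -1" by (subst prod.delta) auto
      finally show ?thesis .
    qed
    moreover have "det (transpose (lorentz_rep B) ** lorentz ** lorentz_rep B) = det lorentz"
      by (simp add: lorentz_rep_isometry[OF B(1)])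
    ultimately show ?thesis by (simp add: det_mul power2_eq_square)
  qed
  ultimately show ?thesis by simp
qed

lemma mem_psl_class: "B \<in> psl_class A \<longleftrightarrow> B = A \<or> B = - A"
proof -
  have "mat (-1) ** A = - A" by (simp add: mat_mult_left vec_eq_iff)
  then show ?thesis by (auto simp: psl_class_def r_coset_def SL2C_def)
qed

definition point_matrix :: "complex \<Rightarrow> real \<Rightarrow> complex^2^2" where
  "point_matrix w t = vector [vector [of_real ((cmod w)\<^sup>2 + t\<^sup>2), w], vector [cnj w, 1]]"

definition infinity_matrix :: "complex^2^2" where
  "infinity_matrix = vector [vector [1, 0], vector [0, 0]]"

lemma ctrans_point_matrix [simp]: "ctrans (point_matrix w t) = point_matrix w t"
  "ctrans infinity_matrix = infinity_matrix"
  by (simp_all add: vec_eq_iff forall_2 point_matrix_def infinity_matrix_def)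

lemma klein_point_matrix:
  "klein (point_matrix w t) = (4 + (cmod w)\<^sup>2 + t\<^sup>2) *\<^sub>R homogeneous (g_map (w, t))"
proof -
  have "4 + (cmod w)\<^sup>2 + t\<^sup>2 > 0" by (smt (verit) zero_le_power2)
  then have "4 + ((Re w)\<^sup>2 + (Im w)\<^sup>2 + t\<^sup>2) \<noteq> 0" by (simp add: cmod_power2 add.assoc)
  then show ?thesis
    by (simp add: klein_def point_matrix_def homogeneous_def g_map_def Let_def vec_eq_iff forall_4
        cmod_power2 add.assoc)
qed

lemma klein_infinity_matrix: "klein infinity_matrix = homogeneous (g_boundary None)"
  by (simp add: klein_def infinity_matrix_def homogeneous_def g_boundary_def vec_eq_iff forall_4)

lemma cmod_sq: "(complex_of_real (cmod z))\<^sup>2 = z * cnj z"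
  by (metis complex_norm_square of_real_power)

text \<open>The denominator of the Poincare extension is the lower right entry of \<open>A E A\<^sup>*\<close>; the upper left entry
then has to be right because determinants agree.  Height zero covers the finite boundary points whose
image is finite.\<close>

lemma congruence_point_matrix:
  assumes "det A = 1" "t \<ge> 0" and D: "(cmod (A$2$1 * w + A$2$2))\<^sup>2 + (cmod (A$2$1))\<^sup>2 * t\<^sup>2 \<noteq> 0" (is "?D \<noteq> 0")
  shows "A ** point_matrix w t ** ctrans A =
    mat (of_real ?D) ** point_matrix (fst (upper_action A (w, t))) (snd (upper_action A (w, t)))"
proof -
  define a b c d where abcd: "a = A$1$1" "b = A$1$2" "c = A$2$1" "d = A$2$2"
  define u v where uv: "u = a * w + b" "v = c * w + d"
  define T where "T = complex_of_real (t\<^sup>2)"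
  define N where "N = u * cnj v + a * cnj c * T"
  define DD where "DD = ?D"
  have D: "DD \<noteq> 0" using D by (simp add: DD_def)
  have DC: "of_real DD = v * cnj v + c * cnj c * T"
    by (simp add: DD_def abcd uv T_def cmod_sq)
  have det: "a * v - u * c = 1" using assms(1) by (simp add: abcd uv det_2 algebra_simps)
  have up: "upper_action A (w, t) = (N / of_real DD, t / DD)"
    by (simp add: upper_action_def Let_def N_def abcd uv DD_def T_def)
  have T: "cnj T = T" by (simp add: T_def)
  have "(u * cnj u + a * cnj a * T) * of_real DD = N * cnj N + T * ((a * v - u * c) * cnj (a * v - u * c))"
    unfolding DC N_def by (simp add: T algebra_simps)
  then have "(u * cnj u + a * cnj a * T) * of_real DD = N * cnj N + T" by (simp add: det)
  then have e11: "u * cnj u + a * cnj a * T = (N * cnj N + T) / of_real DD"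
    using D by (simp add: field_simps)
  have P11: "point_matrix w t $ 1 $ 1 = w * cnj w + T"
    by (simp add: point_matrix_def T_def cmod_sq)
  have Q11: "of_real DD * point_matrix (N / of_real DD) (t / DD) $ 1 $ 1 = (N * cnj N + T) / of_real DD"
  proof -
    have "point_matrix (N / of_real DD) (t / DD) $ 1 $ 1 = (N / of_real DD) * cnj (N / of_real DD) + T / (of_real DD)\<^sup>2"
      by (simp add: point_matrix_def T_def power_divide cmod_sq)
    then show ?thesis using D by (simp add: field_simps power2_eq_square)
  qed
  have "(A ** point_matrix w t ** ctrans A) $ 1 $ 1 = u * cnj u + a * cnj a * T"
    unfolding mat2_mult P11 by (simp add: point_matrix_def uv abcd[symmetric] algebra_simps)
  moreover have "(A ** point_matrix w t ** ctrans A) $ 1 $ 2 = N"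
    unfolding mat2_mult P11 by (simp add: point_matrix_def uv N_def abcd[symmetric] algebra_simps)
  moreover have "(A ** point_matrix w t ** ctrans A) $ 2 $ 1 = cnj N"
    unfolding mat2_mult P11 by (simp add: point_matrix_def uv N_def abcd[symmetric] T algebra_simps)
  moreover have "(A ** point_matrix w t ** ctrans A) $ 2 $ 2 = of_real DD"
    unfolding mat2_mult P11 DC by (simp add: point_matrix_def uv abcd[symmetric] algebra_simps)
  ultimately show ?thesis
    unfolding up DD_def[symmetric] using D
    by (simp add: vec_eq_iff forall_2 e11 Q11 mat_mult_left del: mat2_mult) (simp add: point_matrix_def)
qed

lemma same_point_scale: "k \<noteq> 0 \<Longrightarrow> same_point u v \<Longrightarrow> same_point (k *\<^sub>R u) v"
  unfolding same_point_def by (metis mult_eq_0_iff scaleR_scaleR)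

lemma same_point_lorentz_rep:
  assumes E: "ctrans E = E" and "klein E = r *\<^sub>R p" "r \<noteq> 0"
    and "A ** E ** ctrans A = mat (of_real k) ** F" "k \<noteq> 0" and "klein F = s *\<^sub>R q" "s \<noteq> 0"
  shows "same_point (lorentz_rep A *v p) q"
proof -
  have "r *\<^sub>R (lorentz_rep A *v p) = lorentz_rep A *v klein E"
    using assms(2) by (simp add: matrix_vector_mult_scaleR)
  also have "\<dots> = (k * s) *\<^sub>R q"
    using assms(4,6) by (simp add: lorentz_rep_klein[OF E] klein_scale)
  finally have *: "r *\<^sub>R (lorentz_rep A *v p) = (k * s) *\<^sub>R q" .
  have "lorentz_rep A *v p = (1 / r) *\<^sub>R (r *\<^sub>R (lorentz_rep A *v p))" using assms(3) by simp
  also have "\<dots> = (k * s / r) *\<^sub>R q" unfolding * by simp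
  finally show ?thesis
    using assms(3,5,7) unfolding same_point_def by (intro exI[of _ "k * s / r"]) simp
qed

lemma klein_point_matrix_factor_nonzero: "4 + (cmod w)\<^sup>2 + t\<^sup>2 \<noteq> 0"
  by (smt (verit) zero_le_power2)

text \<open>Interior points, finite boundary points and \<open>\<infinity>\<close> are all rays of Hermitian matrices, so the cases
differ only in which entry of \<open>A E A\<^sup>*\<close> can be normalised to one.\<close>

lemma represents_lorentz_rep:
  assumes "det A = 1"
  shows "represents (pgl_class (lorentz_rep A)) (psl_class A)"
proof -
  note sp = same_point_lorentz_rep[OF ctrans_point_matrix(1) klein_point_matrix klein_point_matrix_factor_nonzero]
  note pf = klein_point_matrix klein_point_matrix_factor_nonzero
  have klein_inf: "klein infinity_matrix = 1 *\<^sub>R homogeneous (g_boundary None)"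
    by (simp add: klein_infinity_matrix)
  have inner: "same_point (lorentz_rep A *v homogeneous (g_map (w, t))) (homogeneous (g_map (upper_action A (w, t))))"
    if "det A = 1" "t \<ge> 0" "(cmod (A$2$1 * w + A$2$2))\<^sup>2 + (cmod (A$2$1))\<^sup>2 * t\<^sup>2 \<noteq> 0" for A w t
    using sp[OF congruence_point_matrix[OF that] that(3) pf] by simp
  have bdry: "same_point (lorentz_rep A *v homogeneous (g_boundary p)) (homogeneous (g_boundary (moebius A p)))"
    if d: "det A = 1" for A p
  proof (cases p)
    case None
    note spi = same_point_lorentz_rep[OF ctrans_point_matrix(2) klein_inf one_neq_zero]
    show ?thesis
    proof (cases "A$2$1 = 0")
      case True
      then have "A$1$1 \<noteq> 0" using d by (auto simp: det_2)
      moreover have "A ** infinity_matrix ** ctrans A = mat (of_real ((cmod (A$1$1))\<^sup>2)) ** infinity_matrix"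
        using True by (simp add: vec_eq_iff forall_2 infinity_matrix_def mat_def cmod_sq)
      ultimately show ?thesis
        using spi[OF _ _ klein_inf one_neq_zero, of A "(cmod (A$1$1))\<^sup>2"] True None by (simp add: moebius_def)
    next
      case False
      have "A ** infinity_matrix ** ctrans A = mat (of_real ((cmod (A$2$1))\<^sup>2)) ** point_matrix (A$1$1 / A$2$1) 0"
        using False
        by (simp add: vec_eq_iff forall_2 infinity_matrix_def point_matrix_def mat_mult_left norm_divide power_divide cmod_sq)
      then show ?thesis
        using spi[OF _ _ pf, of A "(cmod (A$2$1))\<^sup>2"] False None by (simp add: moebius_def g_boundary_def)
    qed
  next
    case (Some w)
    show ?thesis
    proof (cases "A$2$1 * w + A$2$2 = 0")
      case True
      have "A$1$1 * w + A$1$2 \<noteq> 0"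
      proof
        assume "A$1$1 * w + A$1$2 = 0"
        then have "A$1$1 * A$2$2 - A$1$2 * A$2$1 = 0" using True by algebra
        then show False using d by (simp add: det_2)
      qed
      moreover have "A ** point_matrix w 0 ** ctrans A = mat (of_real ((cmod (A$1$1 * w + A$1$2))\<^sup>2)) ** infinity_matrix"
      proof -
        have e: "A$2$2 = - (A$2$1 * w)" using True by (simp add: add_eq_0_iff)
        show ?thesis
          unfolding vec_eq_iff forall_2 mat2_mult ctrans_nth e
          by (simp add: point_matrix_def infinity_matrix_def mat_def e algebra_simps cmod_sq)
      qed
      ultimately show ?thesis
        using sp[OF _ _ klein_inf one_neq_zero, of A w 0 "(cmod (A$1$1 * w + A$1$2))\<^sup>2"] True Some
        by (simp add: moebius_def g_boundary_def)
    next
      case False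
      then have "fst (upper_action A (w, 0)) = (A$1$1 * w + A$1$2) / (A$2$1 * w + A$2$2)"
        by (simp add: upper_action_def Let_def cmod_sq del: complex_cnj_add complex_cnj_mult)
      moreover have "snd (upper_action A (w, 0)) = 0" by (simp add: upper_action_def Let_def)
      ultimately have "upper_action A (w, 0) = ((A$1$1 * w + A$1$2) / (A$2$1 * w + A$2$2), 0)"
        by (simp add: prod_eq_iff)
      then show ?thesis using inner[OF d, of 0 w] False Some by (simp add: moebius_def g_boundary_def)
    qed
  qed
  show ?thesis
    unfolding represents_def
  proof (intro ballI conjI allI impI)
    fix M B assume "M \<in> pgl_class (lorentz_rep A)" "B \<in> psl_class A"
    then obtain k where k: "k \<noteq> 0" and M: "M = k *\<^sub>R lorentz_rep B" and B: "det B = 1"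
      using assms by (auto simp: mem_pgl_class mem_psl_class det_2)
    have Mv: "M *v v = k *\<^sub>R (lorentz_rep B *v v)" for v by (simp add: M scaleR_matrix_vector_assoc)
    show "same_point (M *v homogeneous (g_boundary p)) (homogeneous (g_boundary (moebius B p)))" for p
      unfolding Mv by (rule same_point_scale[OF k bdry[OF B]])
    fix w and t :: real assume t: "t > 0"
    have "(cmod (B$2$1 * w + B$2$2))\<^sup>2 + (cmod (B$2$1))\<^sup>2 * t\<^sup>2 \<noteq> 0"
    proof
      assume "(cmod (B$2$1 * w + B$2$2))\<^sup>2 + (cmod (B$2$1))\<^sup>2 * t\<^sup>2 = 0"
      then have "B$2$1 = 0" "B$2$1 * w + B$2$2 = 0" using t by (auto simp: add_nonneg_eq_0_iff)
      then show False using B by (simp add: det_2)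
    qed
    then show "same_point (M *v homogeneous (g_map (w, t))) (homogeneous (g_map (upper_action B (w, t))))"
      unfolding Mv using same_point_scale[OF k inner[OF B]] t by simp
  qed
qed


section \<open>The two holonomies over the gluing variety\<close>

text \<open>The exponentials of the two equations are inverse to each other, so one of them carries all the
algebraic information.\<close>

lemma gluing_imp_curve:
  assumes "Im z1 > 0" "Im z2 > 0" "gluing_equations z1 z2"
  shows "(z1 * (1 - z2))\<^sup>2 = z2 * (1 - z1)"
proof -
  have nz: "z1 \<noteq> 0" "z2 \<noteq> 0" "1 - z1 \<noteq> 0" "1 - z2 \<noteq> 0" "1 - 1 / z2 \<noteq> 0"
    using assms(1,2) by auto
  have "exp (2 * Ln z1 + Ln (1 / (1 - z1)) + Ln z2 + 2 * Ln (1 - 1 / z2)) = exp (2 * of_real pi * \<i>)"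
    using assms(3) by (simp add: gluing_equations_def)
  then have "z1\<^sup>2 * (1 / (1 - z1)) * z2 * (1 - 1 / z2)\<^sup>2 = 1"
    using nz by (simp add: exp_add exp_double)
  then have "z2 * (z1\<^sup>2 * (z2 - 1)\<^sup>2) = z2 * (z2 * (1 - z1))"
    using nz by (simp add: field_simps power2_eq_square)
  then have "z1\<^sup>2 * (z2 - 1)\<^sup>2 = z2 * (1 - z1)"
    using nz by simp
  then show ?thesis by algebra
qed

lemma csqrt_nonzero:
  assumes "Im z1 > 0" "Im z2 > 0" shows "csqrt (z1 * (1 - z2)) \<noteq> 0"
  using assms by auto

lemma det_rho_matrix:
  assumes "Im z1 > 0" "Im z2 > 0"
  shows "det (rho_matrix z1 z2 s) = 1"
proof -
  have "csqrt (z1 * (1 - z2)) \<noteq> 0" by (rule csqrt_nonzero[OF assms])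
  then show ?thesis by (cases s) (simp_all add: rho_matrix_def Let_def det_2)
qed

lemma inv_SL2C:
  assumes "det A = 1"
  shows "inv\<^bsub>SL2C\<^esub> A = vector [vector [A$2$2, - A$1$2], vector [- A$2$1, A$1$1]]" (is "_ = ?B")
proof (rule group.inv_equality[OF group_SL2C])
  show "?B \<otimes>\<^bsub>SL2C\<^esub> A = \<one>\<^bsub>SL2C\<^esub>"
    using assms by (simp add: SL2C_def vec_eq_iff forall_2 det_2 mat_def algebra_simps)
qed (use assms in \<open>simp_all add: SL2C_def det_2 algebra_simps\<close>)

text \<open>With \<open>q\<^sup>2 = z\<^sub>1(1 - z\<^sub>2)\<close> the curve becomes the Riley polynomial condition
\<open>q\<^sup>4(1 - z\<^sub>2) = z\<^sub>2(1 - z\<^sub>2 - q\<^sup>2)\<close>.  The relation holds in SL(2,C) itself and not only up to sign, so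
that both holonomies factor through one homomorphism.\<close>

lemma rho_matrix_relation:
  assumes "Im z1 > 0" "Im z2 > 0" and curve: "(z1 * (1 - z2))\<^sup>2 = z2 * (1 - z1)"
    and uv: "(u, v) \<in> fig8_relations"
  shows "eval_word SL2C (rho_matrix z1 z2) u = eval_word SL2C (rho_matrix z1 z2) v"
proof -
  define q where "q = csqrt (z1 * (1 - z2))"
  define p where "p = 1 / q"
  have q0: "q \<noteq> 0" using csqrt_nonzero[OF assms(1,2)] by (simp add: q_def)
  have q2: "q * q = z1 * (1 - z2)" by (simp add: q_def flip: power2_eq_square)
  have pq: "p * q = 1" using q0 by (simp add: p_def)
  have riley: "q * q * (q * q) * (1 - z2) = z2 * (1 - z2 - q * q)"
    using q2 curve by algebra
  have X: "rho_matrix z1 z2 GX = vector [vector [p, - p], vector [0, q]]"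
    and Y: "rho_matrix z1 z2 GY = vector [vector [q, 0], vector [- (z2 * p), p]]"
    by (simp_all add: rho_matrix_def Let_def q_def p_def)
  have iX: "inv\<^bsub>SL2C\<^esub> (rho_matrix z1 z2 GX) = vector [vector [q, p], vector [0, p]]"
    and iY: "inv\<^bsub>SL2C\<^esub> (rho_matrix z1 z2 GY) = vector [vector [p, 0], vector [z2 * p, q]]"
    by (simp_all add: inv_SL2C det_rho_matrix assms) (simp_all add: X Y)
  have m: "A \<otimes>\<^bsub>SL2C\<^esub> B = A ** B" "\<one>\<^bsub>SL2C\<^esub> = mat 1" for A B by (simp_all add: SL2C_def)
  have "eval_word SL2C (rho_matrix z1 z2) (word_a @ [(GX, True)]) =
     eval_word SL2C (rho_matrix z1 z2) ([(GY, True)] @ word_a)"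
    unfolding word_a_def append_Cons append_Nil eval_word_Cons eval_word_Nil if_True if_False simp_thms m
      iX iY
    unfolding X Y vec_eq_iff forall_2 mat2_mult vector_2
    using pq riley by (intro conjI; simp add: mat_def; algebra)
  then show ?thesis using uv by (auto simp: fig8_relations_def)
qed

lemma psl_class_hom: "psl_class \<in> hom SL2C PSL2C"
  using normal.r_coset_hom_Mod[OF normal_center_SL2C] by (simp add: PSL2C_def psl_class_def[abs_def])

lemma pgl_class_hom: "pgl_class \<in> hom GL4R PGL4R"
  using normal.r_coset_hom_Mod[OF normal_scalars4] by (simp add: PGL4R_def pgl_class_def[abs_def])

lemma lorentz_class_hom: "(\<lambda>A. pgl_class (lorentz_rep A)) \<in> hom SL2C PGL4R"
proof -
  have "lorentz_rep \<in> hom SL2C GL4R"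
    by (auto simp: hom_def SL2C_def GL4R_def invertible_lorentz_rep lorentz_rep_mult)
  then show ?thesis using hom_compose[OF _ pgl_class_hom] by (simp add: comp_def)
qed

lemma pgl_class_scale:
  assumes "k \<noteq> 0" shows "pgl_class (k *\<^sub>R A) = pgl_class A"
proof -
  have "(\<exists>c. c \<noteq> 0 \<and> B = c *\<^sub>R k *\<^sub>R A) \<longleftrightarrow> (\<exists>c. c \<noteq> 0 \<and> B = c *\<^sub>R A)" for B
  proof
    assume "\<exists>c. c \<noteq> 0 \<and> B = c *\<^sub>R A"
    then obtain c where "c \<noteq> 0" "B = c *\<^sub>R A" by blast
    then show "\<exists>c. c \<noteq> 0 \<and> B = c *\<^sub>R k *\<^sub>R A" using assms by (intro exI[of _ "c / k"]) simp
  next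
    assume "\<exists>c. c \<noteq> 0 \<and> B = c *\<^sub>R k *\<^sub>R A"
    then obtain c where "c \<noteq> 0" "B = c *\<^sub>R k *\<^sub>R A" by blast
    then show "\<exists>c. c \<noteq> 0 \<and> B = c *\<^sub>R A" using assms by (intro exI[of _ "c * k"]) simp
  qed
  then show ?thesis by (auto simp: set_eq_iff mem_pgl_class)
qed

lemma lorentz_class_in_PSO31:
  assumes "det A = 1" shows "pgl_class (lorentz_rep A) \<in> carrier PSO31"
  unfolding pgl_class_in_PSO31[OF invertible_lorentz_rep[OF assms]]
  using lorentz_rep_isometry[OF assms] det_lorentz_rep[OF assms] by (auto intro: exI[of _ 1])

text \<open>The factor \<open>\<bar>z\<^sub>1(1 - z\<^sub>2)\<bar> = q cnj q\<close> cancels all denominators of \<open>A E A\<^sup>*\<close>, and only the square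
\<open>q\<^sup>2 = z\<^sub>1(1 - z\<^sub>2)\<close> survives; this is why the square root disappears from the Klein model.\<close>

lemma klein_matrix_lorentz_rep:
  assumes "Im z1 > 0" "Im z2 > 0"
  shows "klein_matrix z1 z2 s =
    ((case s of GX \<Rightarrow> 8 | GY \<Rightarrow> 2) * cmod (z1 * (1 - z2))) *\<^sub>R lorentz_rep (rho_matrix z1 z2 s)"
proof -
  define q where "q = csqrt (z1 * (1 - z2))"
  define A where "A = rho_matrix z1 z2 s"
  define m where "m = cmod (z1 * (1 - z2))"
  have q0: "q \<noteq> 0" using csqrt_nonzero[OF assms(1,2)] by (simp add: q_def)
  have q2: "q * q = z1 * (1 - z2)" by (simp add: q_def flip: power2_eq_square)
  have m: "complex_of_real m = q * cnj q"
    unfolding m_def by (metis complex_norm_square norm_mult power2_eq_square q2)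
  have K: "complex_of_real (m\<^sup>2) = (q * q) * cnj (q * q)"
    by (simp add: m power2_eq_square)
  have "klein_matrix z1 z2 s *v v = ((case s of GX \<Rightarrow> 8 | GY \<Rightarrow> 2) * m) *\<^sub>R (lorentz_rep A *v v)" for v
  proof -
    define a d z where adz: "a = (v$4 - v$3) / 2" "d = (v$4 + v$3) / 8" "z = Complex (v$1 / 4) (v$2 / 4)"
    have h: "herm v = vector [vector [of_real a, z], vector [cnj z, of_real d]]"
      by (simp add: herm_def adz complex_eq_iff vec_eq_iff forall_2)
    have v: "v$1 = 4 * Re z" "v$2 = 4 * Im z" "v$3 = 4 * d - a" "v$4 = 4 * d + a"
      by (simp_all add: adz field_simps)
    have "m *\<^sub>R (lorentz_rep A *v v) = klein (mat (of_real m) ** (A ** herm v ** ctrans A))"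
      by (simp add: klein_scale lorentz_rep_apply)
    moreover have "mat (of_real m) ** (A ** herm v ** ctrans A) = (case s of
        GX \<Rightarrow> vector [vector [of_real a - z - cnj z + of_real d, cnj (q * q) * (z - of_real d)],
                  vector [(q * q) * (cnj z - of_real d), of_real (m\<^sup>2 * d)]]
      | GY \<Rightarrow> vector [vector [of_real (m\<^sup>2 * a), (q * q) * (z - cnj z2 * of_real a)],
                  vector [cnj (q * q) * (cnj z - z2 * of_real a),
                    z2 * cnj z2 * of_real a - z2 * z - cnj z2 * cnj z + of_real d]])" (is "_ = ?E")
      unfolding h vec_eq_iff forall_2 mat_mult_left
      using q0 by (cases s) (simp_all add: A_def rho_matrix_def Let_def K m flip: q_def, simp_all add: field_simps power2_eq_square)
    ultimately have "m *\<^sub>R (lorentz_rep A *v v) = klein ?E" by simp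
    then have "((case s of GX \<Rightarrow> 8 | GY \<Rightarrow> 2) * m) *\<^sub>R (lorentz_rep A *v v) = (case s of GX \<Rightarrow> 8 | GY \<Rightarrow> 2) *\<^sub>R klein ?E"
      by (metis scaleR_scaleR)
    moreover have "\<dots> = klein_matrix z1 z2 s *v v"
      unfolding q2
      by (cases s) (simp_all add: klein_def klein_matrix_def Let_def matrix_vector_mult_def sum_4 vec_eq_iff
          forall_4 v m_def[symmetric] cmod_power2, simp_all add: algebra_simps power2_eq_square)
    ultimately show ?thesis by simp
  qed
  then show ?thesis unfolding A_def m_def matrix_eq by (simp add: scaleR_matrix_vector_assoc)
qed

definition word_matrix :: "complex \<Rightarrow> complex \<Rightarrow> generator word \<Rightarrow> complex^2^2" where
  "word_matrix z1 z2 = eval_word SL2C (rho_matrix z1 z2)"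

lemma gluing_solutionsD:
  assumes "(z1, z2) \<in> gluing_solutions"
  shows "Im z1 > 0" "Im z2 > 0" "(z1 * (1 - z2))\<^sup>2 = z2 * (1 - z1)"
  using assms gluing_imp_curve by (auto simp: gluing_solutions_def)

lemma rho_matrix_closed:
  assumes "(z1, z2) \<in> gluing_solutions"
  shows "rho_matrix z1 z2 s \<in> carrier SL2C"
  using det_rho_matrix gluing_solutionsD[OF assms] by (simp add: SL2C_def)

lemma det_word_matrix:
  assumes "(z1, z2) \<in> gluing_solutions" shows "det (word_matrix z1 z2 w) = 1"
  using eval_word_closed[OF group_SL2C, of "rho_matrix z1 z2"] rho_matrix_closed[OF assms]
  by (simp add: word_matrix_def SL2C_def)

text \<open>Both holonomies are obtained by following the representation into SL(2,C) with a homomorphism \<open>h\<close>.\<close>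

lemma induced_map_of_SL2C_hom:
  assumes sol: "(z1, z2) \<in> gluing_solutions" and K: "group K" and h: "h \<in> hom SL2C K"
  shows "induced_map K (\<lambda>s. h (rho_matrix z1 z2 s)) \<in> hom fig8_group K"
    and "induced_map K (\<lambda>s. h (rho_matrix z1 z2 s)) (word_class fig8_relations w) = h (word_matrix z1 z2 w)"
proof -
  note ev = hom_eval_word[OF group_SL2C rho_matrix_closed[OF sol] K h, symmetric]
  have cl: "h (rho_matrix z1 z2 s) \<in> carrier K" for s
    using rho_matrix_closed[OF sol] h by (auto simp: hom_def)
  have rel: "eval_word K (\<lambda>s. h (rho_matrix z1 z2 s)) u = eval_word K (\<lambda>s. h (rho_matrix z1 z2 s)) v"
    if "(u, v) \<in> fig8_relations" for u v
    unfolding ev using rho_matrix_relation[OF gluing_solutionsD[OF sol] that] by simp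
  show "induced_map K (\<lambda>s. h (rho_matrix z1 z2 s)) \<in> hom fig8_group K"
    unfolding fig8_group_def using K cl rel by (rule induced_map_hom)
  have "induced_map K (\<lambda>s. h (rho_matrix z1 z2 s)) (word_class fig8_relations w) =
      eval_word K (\<lambda>s. h (rho_matrix z1 z2 s)) w"
    using K cl rel by (rule induced_map_word_class)
  then show "induced_map K (\<lambda>s. h (rho_matrix z1 z2 s)) (word_class fig8_relations w) = h (word_matrix z1 z2 w)"
    by (simp add: ev word_matrix_def)
qed

lemma pgl_class_klein_matrix:
  assumes "Im z1 > 0" "Im z2 > 0"
  shows "pgl_class (klein_matrix z1 z2 s) = pgl_class (lorentz_rep (rho_matrix z1 z2 s))"
  unfolding klein_matrix_lorentz_rep[OF assms]
  by (rule pgl_class_scale) (use csqrt_nonzero[OF assms] in \<open>cases s; simp\<close>)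

lemma holonomy_hom:
  assumes sol: "(z1, z2) \<in> gluing_solutions"
  shows "holonomy z1 z2 \<in> hom fig8_group PSL2C"
    and "holonomy z1 z2 (word_class fig8_relations w) = psl_class (word_matrix z1 z2 w)"
  unfolding holonomy_def
  using induced_map_of_SL2C_hom[OF sol group_PSL2C psl_class_hom] by simp_all

lemma klein_holonomy_hom:
  assumes sol: "(z1, z2) \<in> gluing_solutions"
  shows "klein_holonomy z1 z2 \<in> hom fig8_group PGL4R"
    and "klein_holonomy z1 z2 (word_class fig8_relations w) = pgl_class (lorentz_rep (word_matrix z1 z2 w))"
  unfolding klein_holonomy_def pgl_class_klein_matrix[OF gluing_solutionsD(1,2)[OF sol]]
  using induced_map_of_SL2C_hom[OF sol group_PGL4R lorentz_class_hom] by simp_all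

lemma carrier_fig8_group: "carrier fig8_group = range (word_class fig8_relations)"
  by (simp add: fig8_group_def presented_group_def)

lemma klein_holonomy_hom_PSO31:
  assumes sol: "(z1, z2) \<in> gluing_solutions"
  shows "klein_holonomy z1 z2 \<in> hom fig8_group PSO31"
proof (rule homI)
  fix P Q assume PQ: "P \<in> carrier fig8_group" "Q \<in> carrier fig8_group"
  show "klein_holonomy z1 z2 P \<in> carrier PSO31"
    using PQ(1) lorentz_class_in_PSO31[OF det_word_matrix[OF sol]]
    by (auto simp: carrier_fig8_group klein_holonomy_hom(2)[OF sol])
  show "klein_holonomy z1 z2 (P \<otimes>\<^bsub>fig8_group\<^esub> Q) =
      klein_holonomy z1 z2 P \<otimes>\<^bsub>PSO31\<^esub> klein_holonomy z1 z2 Q"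
    using hom_mult[OF klein_holonomy_hom(1)[OF sol] PQ] by (simp add: PSO31_def)
qed

lemma word_matrix_generator:
  "word_matrix z1 z2 [(s, True)] = rho_matrix z1 z2 s"
  by (simp add: word_matrix_def SL2C_def)

lemma representation_properties:
  assumes sol: "(z1, z2) \<in> gluing_solutions"
  shows "holonomy z1 z2 (fig8_gen s) = psl_class (rho_matrix z1 z2 s)"
    and "klein_holonomy z1 z2 (fig8_gen s) = pgl_class (klein_matrix z1 z2 s)"
    and "pgl_class (klein_matrix z1 z2 s) \<in> carrier PSO31"
    and "\<gamma> \<in> carrier fig8_group \<Longrightarrow> represents (klein_holonomy z1 z2 \<gamma>) (holonomy z1 z2 \<gamma>)"
proof -
  note d = gluing_solutionsD(1,2)[OF sol]
  show "holonomy z1 z2 (fig8_gen s) = psl_class (rho_matrix z1 z2 s)"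
    by (simp add: fig8_gen_def holonomy_hom[OF sol] word_matrix_generator)
  show "klein_holonomy z1 z2 (fig8_gen s) = pgl_class (klein_matrix z1 z2 s)"
    by (simp add: fig8_gen_def klein_holonomy_hom[OF sol] word_matrix_generator pgl_class_klein_matrix[OF d])
  show "pgl_class (klein_matrix z1 z2 s) \<in> carrier PSO31"
    unfolding pgl_class_klein_matrix[OF d] by (rule lorentz_class_in_PSO31[OF det_rho_matrix[OF d]])
  show "represents (klein_holonomy z1 z2 \<gamma>) (holonomy z1 z2 \<gamma>)" if "\<gamma> \<in> carrier fig8_group"
    using that represents_lorentz_rep[OF det_word_matrix[OF sol]]
    by (auto simp: carrier_fig8_group holonomy_hom[OF sol] klein_holonomy_hom[OF sol])
qed

lemma real_polynomial_Re_Im: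
  "real_polynomial_function (\<lambda>z :: complex \<times> complex. Re (fst z))"
  "real_polynomial_function (\<lambda>z :: complex \<times> complex. Im (fst z))"
  "real_polynomial_function (\<lambda>z :: complex \<times> complex. Re (snd z))"
  "real_polynomial_function (\<lambda>z :: complex \<times> complex. Im (snd z))"
  by (rule real_polynomial_function.intros(1)[OF bounded_linear_compose[OF bounded_linear_Re bounded_linear_fst]]
      real_polynomial_function.intros(1)[OF bounded_linear_compose[OF bounded_linear_Im bounded_linear_fst]]
      real_polynomial_function.intros(1)[OF bounded_linear_compose[OF bounded_linear_Re bounded_linear_snd]]
      real_polynomial_function.intros(1)[OF bounded_linear_compose[OF bounded_linear_Im bounded_linear_snd]])+

lemma real_polynomial_klein_matrix:
  "real_polynomial_function (\<lambda>z. klein_matrix (fst z) (snd z) s $ i $ j)"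
proof -
  have "\<forall>i j. real_polynomial_function (\<lambda>z. klein_matrix (fst z) (snd z) s $ i $ j)"
    unfolding forall_4
    by (cases s; simp add: klein_matrix_def Let_def cmod_power2; intro conjI)
      (rule real_polynomial_Re_Im real_polynomial_function_diff real_polynomial_function_minus
        real_polynomial_function_power real_polynomial_function.intros(2,3,4))+
  then show ?thesis by blast
qed

lemma rational_klein_matrix:
  "rational_function_on D (\<lambda>(z1, z2). klein_matrix z1 z2 s $ i $ j)"
  unfolding rational_function_on_def
  by (intro exI[of _ "\<lambda>z. klein_matrix (fst z) (snd z) s $ i $ j"] exI[of _ "\<lambda>_. 1"] conjI)
    (auto intro: real_polynomial_klein_matrix real_polynomial_function.intros(2))

text \<open>A continuous lift of \<open>klein_holonomy\<close> to matrices.  The inverse letter uses the Lorentz adjoint, which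
is a multiple of the inverse matrix and polynomial in the parameters.  Lifting through \<open>lorentz_rep\<close>
would pass through the square root in \<open>rho_matrix\<close>, which has a branch cut.\<close>

fun klein_word :: "complex \<times> complex \<Rightarrow> generator word \<Rightarrow> real^4^4" where
  "klein_word z [] = mat 1"
| "klein_word z ((s, b) # w) =
     (if b then klein_matrix (fst z) (snd z) s
      else lorentz ** transpose (klein_matrix (fst z) (snd z) s) ** lorentz) ** klein_word z w"

lemma continuous_klein_word: "continuous_on S (\<lambda>z. klein_word z w)"
proof -
  have "\<forall>i j. continuous_on S (\<lambda>z. klein_word z w $ i $ j)"
  proof (induction w)
    case Nil
    then show ?case by simp
  next
    case (Cons l w)
    obtain s b where l: "l = (s, b)" by fastforce
    have "continuous_on S (\<lambda>z. klein_matrix (fst z) (snd z) s $ i $ j)" for i j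
      by (intro continuous_on_polymonial_function) (simp add: real_polynomial_klein_matrix flip: real_polynomial_function_eq)
    then show ?case using Cons
      by (cases b) (simp_all add: l matrix_matrix_mult_def transpose_def continuous_on_sum continuous_on_mult continuous_on_const)
  qed
  then have "continuous_on S (\<lambda>z. \<chi> i j. klein_word z w $ i $ j)"
    by (intro continuous_on_vec_lambda) simp
  then show ?thesis by simp
qed

lemma lorentz_square: "lorentz ** lorentz = mat 1"
  by (simp add: lorentz_def matrix_matrix_mult_def mat_def vec_eq_iff sum_4 forall_4)

lemma lorentz_rep_inverse:
  assumes "A \<in> carrier SL2C"
  shows "lorentz_rep (inv\<^bsub>SL2C\<^esub> A) = lorentz ** transpose (lorentz_rep A) ** lorentz"
proof -
  interpret S: group SL2C by (rule group_SL2C)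
  have d: "det A = 1" using assms by (simp add: SL2C_def)
  have "A ** inv\<^bsub>SL2C\<^esub> A = mat 1" using S.r_inv[OF assms] by (simp add: SL2C_def)
  then have "lorentz_rep A ** lorentz_rep (inv\<^bsub>SL2C\<^esub> A) = mat 1"
    by (metis lorentz_rep_mult lorentz_rep_one)
  moreover define L where "L = lorentz ** transpose (lorentz_rep A) ** lorentz"
  have "L ** lorentz_rep A = lorentz ** (transpose (lorentz_rep A) ** lorentz ** lorentz_rep A)"
    by (simp add: L_def matrix_mul_assoc)
  then have "L ** lorentz_rep A = mat 1"
    by (simp add: lorentz_rep_isometry[OF d] lorentz_square)
  moreover have "L ** (lorentz_rep A ** R) = (L ** lorentz_rep A) ** R" for R :: "real^4^4"
    by (rule matrix_mul_assoc)
  ultimately show ?thesis by (metis L_def matrix_mul_lid matrix_mul_rid)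
qed

lemma klein_word_scaled:
  assumes sol: "(z1, z2) \<in> gluing_solutions"
  shows "\<exists>c. c \<noteq> 0 \<and> klein_word (z1, z2) w = c *\<^sub>R lorentz_rep (word_matrix z1 z2 w)"
proof (induction w)
  case Nil
  show ?case by (intro exI[of _ 1]) (simp add: word_matrix_def SL2C_def)
next
  case (Cons l w)
  then obtain c where c: "c \<noteq> 0" "klein_word (z1, z2) w = c *\<^sub>R lorentz_rep (word_matrix z1 z2 w)" by blast
  obtain s b where l: "l = (s, b)" by fastforce
  define k where "k = (case s of GX \<Rightarrow> 8 | GY \<Rightarrow> 2) * cmod (z1 * (1 - z2))"
  have k: "k \<noteq> 0" using csqrt_nonzero[OF gluing_solutionsD(1,2)[OF sol]]
    by (cases s) (simp_all add: k_def)
  have ks: "klein_matrix z1 z2 s = k *\<^sub>R lorentz_rep (rho_matrix z1 z2 s)"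
    unfolding k_def by (rule klein_matrix_lorentz_rep[OF gluing_solutionsD(1,2)[OF sol]])
  have tr: "transpose (k *\<^sub>R M) = k *\<^sub>R transpose M" for M :: "real^4^4" by (simp add: transpose_def vec_eq_iff)
  have "klein_word (z1, z2) (l # w) = (k * c) *\<^sub>R lorentz_rep (word_matrix z1 z2 (l # w))"
    using lorentz_rep_inverse[OF rho_matrix_closed[OF sol], of s]
    by (simp add: l ks c(2) tr word_matrix_def lorentz_rep_mult scaleR_mm_left scaleR_mm_right)
      (simp add: SL2C_def lorentz_rep_mult)
  then show ?case using k c(1) by (intro exI[of _ "k * c"]) simp
qed

text \<open>Translates between sets of classes and their unions, in terms of which the topology of PGL(4,R) is
defined.\<close>

lemma pgl_class_mem_iff:
  assumes "U \<subseteq> carrier PGL4R"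
  shows "pgl_class M \<in> U \<longleftrightarrow> M \<in> \<Union>U"
proof
  assume "pgl_class M \<in> U"
  moreover have "M \<in> pgl_class M" unfolding mem_pgl_class by (intro exI[of _ 1]) simp
  ultimately show "M \<in> \<Union>U" by blast
next
  assume "M \<in> \<Union>U"
  then obtain A where A: "pgl_class A \<in> U" "M \<in> pgl_class A"
    using assms by (auto simp: carrier_PGL4R)
  then obtain c where "c \<noteq> 0" "M = c *\<^sub>R A" by (auto simp: mem_pgl_class)
  then show "pgl_class M \<in> U" using A(1) pgl_class_scale by simp
qed

lemma continuous_on_det: "continuous_on S (det :: real^'n^'n \<Rightarrow> real)"
  unfolding det_def by (intro continuous_intros)

lemma topspace_PGL4R: "topspace PGL4R_topology = carrier PGL4R"
proof -
  have eq: "\<Union>(carrier PGL4R) = {A. det A \<noteq> 0}"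
  proof (intro equalityI subsetI)
    fix A assume "A \<in> \<Union>(carrier PGL4R)"
    then obtain B c where B: "invertible B" "c \<noteq> 0" "A = c *\<^sub>R B"
      by (auto simp: carrier_PGL4R mem_pgl_class)
    then have "A = mat c ** B" by (simp add: mat_mult_left vec_eq_iff)
    then show "A \<in> {A. det A \<noteq> 0}" using B by (simp add: det_mul invertible_det_nz det_diagonal mat_def)
  next
    fix A :: "real^4^4" assume "A \<in> {A. det A \<noteq> 0}"
    then have "pgl_class A \<in> carrier PGL4R" by (simp add: carrier_PGL4R invertible_det_nz)
    then show "A \<in> \<Union>(carrier PGL4R)" using pgl_class_mem_iff[of "carrier PGL4R"] by simp
  qed
  have "open {A :: real^4^4. det A \<noteq> 0}"
    by (intro open_Collect_neq continuous_on_det continuous_on_const)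
  then have "openin PGL4R_topology (carrier PGL4R)" by (simp add: openin_PGL4R eq)
  then show ?thesis by (auto simp: topspace_def openin_PGL4R)
qed

lemma continuous_klein_holonomy:
  assumes "\<gamma> \<in> carrier fig8_group"
  shows "continuous_map (top_of_set gluing_solutions) PGL4R_topology (\<lambda>(z1, z2). klein_holonomy z1 z2 \<gamma>)"
proof -
  obtain w where w: "\<gamma> = word_class fig8_relations w" using assms by (auto simp: carrier_fig8_group)
  have eq: "klein_holonomy z1 z2 \<gamma> = pgl_class (klein_word (z1, z2) w)" if sol: "(z1, z2) \<in> gluing_solutions" for z1 z2
    using klein_word_scaled[OF sol, of w] pgl_class_scale by (auto simp: w klein_holonomy_hom[OF sol])
  have pre: "{z \<in> gluing_solutions. (case z of (z1, z2) \<Rightarrow> klein_holonomy z1 z2 \<gamma>) \<in> U} =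
      gluing_solutions \<inter> (\<lambda>z. klein_word z w) -` (\<Union>U)" if "U \<subseteq> carrier PGL4R" for U
    using eq pgl_class_mem_iff[OF that] by auto
  show ?thesis
    unfolding continuous_map_def
  proof (intro conjI allI impI funcsetI)
    fix z assume "z \<in> topspace (top_of_set gluing_solutions)"
    then show "(case z of (z1, z2) \<Rightarrow> klein_holonomy z1 z2 \<gamma>) \<in> topspace PGL4R_topology"
      using klein_holonomy_hom(1) assms by (cases z) (auto simp: topspace_PGL4R hom_def)
  next
    fix U assume "openin PGL4R_topology U"
    then have U: "U \<subseteq> carrier PGL4R" "open (\<Union>U)" by (auto simp: openin_PGL4R)
    have "openin (top_of_set gluing_solutions) (gluing_solutions \<inter> (\<lambda>z. klein_word z w) -` (\<Union>U))"
      by (rule continuous_openin_preimage_gen[OF continuous_klein_word U(2)])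
    then show "openin (top_of_set gluing_solutions)
        {z \<in> topspace (top_of_set gluing_solutions). (case z of (z1, z2) \<Rightarrow> klein_holonomy z1 z2 \<gamma>) \<in> U}"
      using pre[OF U(1)] by simp
  qed
qed


section \<open>The complete structure and an arc of deformations\<close>

definition omega :: complex where
  "omega = Complex (1/2) (sqrt 3 / 2)"

lemma omega_simps [simp]: "Re omega = 1/2" "Im omega = sqrt 3 / 2"
  by (simp_all add: omega_def)

lemma exp_pi_third: "exp (of_real pi * \<i> / 3) = omega"
proof -
  have "exp (of_real pi * \<i> / 3) = cis (pi / 3)" by (simp add: cis_conv_exp mult.commute)
  then show ?thesis by (simp add: complex_eq_iff cos_60 sin_60)
qed

lemma complete_point_eq: "complete_point = (omega, omega)"
  by (simp add: complete_point_def exp_pi_third)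

lemma omega_square: "omega\<^sup>2 = omega - 1"
  by (simp add: complex_eq_iff power2_eq_square)

lemma omega_nonzero: "omega \<noteq> 0" "omega \<noteq> 1" "1 - omega \<noteq> 0"
  by (auto simp: complex_eq_iff)

lemma omega_shape_parameters: "1 / (1 - omega) = omega" "1 - 1 / omega = omega"
proof -
  have "omega * (1 - omega) = 1" using omega_square by (simp add: power2_eq_square algebra_simps)
  then show "1 / (1 - omega) = omega" using omega_nonzero by (simp add: field_simps)
  show "1 - 1 / omega = omega"
    using omega_nonzero omega_square by (simp add: field_simps power2_eq_square)
qed

lemma Ln_omega: "Ln omega = of_real pi * \<i> / 3"
  unfolding exp_pi_third[symmetric] by (rule Ln_exp) (auto simp: pi_gt_zero intro: order.strict_trans[of _ 0])

lemma complete_point_in_gluing_solutions: "complete_point \<in> gluing_solutions"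
  by (simp add: complete_point_eq gluing_solutions_def gluing_equations_def omega_shape_parameters Ln_omega)

text \<open>The solutions of \<open>exp E = 1\<close> are \<open>2\<pi>\<close> apart, so a logarithmic gluing equation is implied by its
exponential near a point where it holds.\<close>

lemma exp_eq_1_near:
  assumes "exp E = 1" "cmod (E - 2 * of_real pi * \<i>) < 2 * pi"
  shows "E = 2 * of_real pi * \<i>"
proof -
  obtain n :: int where n: "Re E = 0" "Im E = of_int (2 * n) * pi"
    using assms(1) by (auto simp: exp_eq_1)
  have "\<bar>Im (E - 2 * of_real pi * \<i>)\<bar> < 2 * pi"
    using assms(2) abs_Im_le_cmod[of "E - 2 * of_real pi * \<i>"] by linarith
  then have "\<bar>(of_int n - 1) * (2 * pi)\<bar> < 1 * (2 * pi)" using n by (simp add: algebra_simps)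
  then have "\<bar>real_of_int n - 1\<bar> < 1" by (simp add: abs_mult)
  then have "n = 1" by linarith
  then show ?thesis using n by (simp add: complex_eq_iff)
qed

text \<open>Take \<open>z\<^sub>2 = e\<^sup>i\<^sup>\<pi>\<^sup>/\<^sup>3 + t\<close> for small \<open>t \<ge> 0\<close> and solve \<open>z\<^sub>1\<^sup>2(1 - z\<^sub>2)\<^sup>2 + z\<^sub>1 z\<^sub>2 - z\<^sub>2 = 0\<close> for \<open>z\<^sub>1\<close>.  At
\<open>t = 0\<close> the discriminant \<open>D\<close> avoids the branch cut of \<open>csqrt\<close>, and the principal branch gives the
complete point.\<close>

lemma exists_arc:
  "\<exists>p. arc p \<and> path_image p \<subseteq> gluing_solutions \<and> pathstart p = complete_point"
proof -
  define z2 where "z2 t = omega + complex_of_real t" for t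
  define D where "D t = (z2 t)\<^sup>2 + 4 * z2 t * (1 - z2 t)\<^sup>2" for t
  define z1 where "z1 t = (csqrt (D t) - z2 t) / (2 * (1 - z2 t)\<^sup>2)" for t
  define E1 where "E1 t = 2 * Ln (z1 t) + Ln (1 / (1 - z1 t)) + Ln (z2 t) + 2 * Ln (1 - 1 / z2 t)" for t
  define E2 where "E2 t = Ln (1 / (1 - z1 t)) + 2 * Ln (1 - 1 / z1 t) + Ln (z2 t) + 2 * Ln (1 / (1 - z2 t))" for t
  have Im2: "Im (z2 t) > 0" for t by (simp add: z2_def)
  have z2n: "z2 t \<noteq> 0" "1 - z2 t \<noteq> 0" for t using Im2[of t] by auto
  have D0: "D 0 = Complex (3/2) (- 3 * sqrt 3 / 2)"
    by (simp add: D_def z2_def complex_eq_iff power2_eq_square algebra_simps)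
  have root: "csqrt (D 0) = Complex (3/2) (- sqrt 3 / 2)"
    by (rule csqrt_unique) (simp_all add: D0 complex_eq_iff power2_eq_square)
  have z20: "z2 0 = omega" by (simp add: z2_def)
  have z10: "z1 0 = omega"
  proof -
    have "csqrt (D 0) - omega = omega * (2 * (1 - omega)\<^sup>2)"
      unfolding root by (simp add: complex_eq_iff power2_eq_square algebra_simps)
    then show ?thesis using omega_nonzero by (simp add: z1_def z20)
  qed
  \<comment> \<open>The logarithms and the square root are continuous off the negative real axis.\<close>
  have nonpos: "w \<notin> \<real>\<^sub>\<le>\<^sub>0" if "Im w \<noteq> 0" for w
    using that by (auto simp: complex_nonpos_Reals_iff)
  have contD: "isCont D t" for t unfolding D_def z2_def by (intro continuous_intros)
  have contz1: "isCont z1 t" if "D t \<notin> \<real>\<^sub>\<le>\<^sub>0" for t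
  proof -
    have "isCont (\<lambda>t. csqrt (D t)) t"
      using continuous_at_compose[OF contD continuous_at_csqrt[OF that]] by (simp add: comp_def)
    moreover have "isCont z2 t" unfolding z2_def by (intro continuous_intros)
    ultimately show ?thesis unfolding z1_def using z2n by (intro continuous_intros) auto
  qed
  have D0': "D 0 \<notin> \<real>\<^sub>\<le>\<^sub>0" by (rule nonpos) (simp add: D0)
  have contz10: "isCont z1 0" by (rule contz1[OF D0'])
  have contz20: "isCont z2 0" unfolding z2_def by (intro continuous_intros)
  have om: "omega \<notin> \<real>\<^sub>\<le>\<^sub>0" by (rule nonpos) simp
  have cE: "isCont E1 0" "isCont E2 0"
    unfolding E1_def E2_def
    by (intro continuous_intros contz10 contz20; simp add: z10 z20 omega_shape_parameters om omega_nonzero)+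
  have E0: "E1 0 = 2 * of_real pi * \<i>" "E2 0 = 2 * of_real pi * \<i>"
    by (simp_all add: E1_def E2_def z10 z20 omega_shape_parameters Ln_omega)
  have tn: "(f \<longlongrightarrow> f 0) (nhds 0)" if "isCont f 0" for f :: "real \<Rightarrow> complex"
    using that by (simp add: isCont_def tendsto_at_iff_tendsto_nhds)
  have "\<forall>\<^sub>F t in nhds 0. cmod (E1 t - 2 * of_real pi * \<i>) < 2 * pi"
    "\<forall>\<^sub>F t in nhds 0. cmod (E2 t - 2 * of_real pi * \<i>) < 2 * pi"
    using tendstoD[OF tn[OF cE(1)], of "2 * pi"] tendstoD[OF tn[OF cE(2)], of "2 * pi"]
    by (simp_all add: dist_norm E0)
  moreover have "\<forall>\<^sub>F t in nhds 0. Im (z1 t) > 0" "\<forall>\<^sub>F t in nhds 0. Im (D t) < 0"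
  proof -
    have "((\<lambda>t. Im (z1 t)) \<longlongrightarrow> Im (z1 0)) (nhds 0)" "((\<lambda>t. Im (D t)) \<longlongrightarrow> Im (D 0)) (nhds 0)"
      by (intro tendsto_Im tn contz10 contD)+
    then show "\<forall>\<^sub>F t in nhds 0. Im (z1 t) > 0" "\<forall>\<^sub>F t in nhds 0. Im (D t) < 0"
      using order_tendstoD[of "\<lambda>t. Im (z1 t)"] order_tendstoD[of "\<lambda>t. Im (D t)"] by (simp_all add: z10 D0)
  qed
  ultimately have "\<forall>\<^sub>F t in nhds 0. cmod (E1 t - 2 * of_real pi * \<i>) < 2 * pi \<and>
      cmod (E2 t - 2 * of_real pi * \<i>) < 2 * pi \<and> Im (z1 t) > 0 \<and> Im (D t) < 0"
    by eventually_elim auto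
  then obtain e where e: "e > 0" and near: "\<And>t. \<bar>t\<bar> < e \<Longrightarrow> cmod (E1 t - 2 * of_real pi * \<i>) < 2 * pi \<and>
      cmod (E2 t - 2 * of_real pi * \<i>) < 2 * pi \<and> Im (z1 t) > 0 \<and> Im (D t) < 0"
    unfolding eventually_nhds_metric by (auto simp: dist_norm)
  have sol: "(z1 t, z2 t) \<in> gluing_solutions" if t: "\<bar>t\<bar> < e" for t
  proof -
    have Im1: "Im (z1 t) > 0" using near[OF t] by simp
    have z1n: "z1 t \<noteq> 0" "1 - z1 t \<noteq> 0" using Im1 by auto
    have n: "1 - 1 / z2 t \<noteq> 0" "1 - 1 / z1 t \<noteq> 0" using z1n z2n[of t] by auto
    have "csqrt (D t) = 2 * (1 - z2 t)\<^sup>2 * z1 t + z2 t"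
      using z2n[of t] by (simp add: z1_def)
    then have "(2 * (1 - z2 t)\<^sup>2 * z1 t + z2 t)\<^sup>2 = (z2 t)\<^sup>2 + 4 * z2 t * (1 - z2 t)\<^sup>2"
      by (metis D_def power2_csqrt)
    then have "4 * (1 - z2 t)\<^sup>2 * ((1 - z2 t)\<^sup>2 * (z1 t)\<^sup>2) = 4 * (1 - z2 t)\<^sup>2 * (z2 t * (1 - z1 t))"
      by algebra
    then have curve: "(1 - z2 t)\<^sup>2 * (z1 t)\<^sup>2 = z2 t * (1 - z1 t)"
      using z2n[of t] by simp
    have "exp (E1 t) = (z1 t)\<^sup>2 * (1 / (1 - z1 t)) * z2 t * (1 - 1 / z2 t)\<^sup>2"
      using z1n z2n[of t] n by (simp add: E1_def exp_add exp_double)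
    also have "\<dots> = ((1 - z2 t)\<^sup>2 * (z1 t)\<^sup>2) / (z2 t * (1 - z1 t))"
      using z1n z2n[of t] by (simp add: field_simps power2_eq_square)
    also have "\<dots> = 1" unfolding curve using z1n z2n[of t] by simp
    finally have 1: "E1 t = 2 * of_real pi * \<i>" using near[OF t] by (intro exp_eq_1_near) auto
    have "exp (E2 t) = (1 / (1 - z1 t)) * (1 - 1 / z1 t)\<^sup>2 * z2 t * (1 / (1 - z2 t))\<^sup>2"
      using z1n z2n[of t] n by (simp add: E2_def exp_add exp_double)
    also have "\<dots> = (1 / (1 - z1 t)) * ((1 - z1 t)\<^sup>2 / (z1 t)\<^sup>2) * z2 t / (1 - z2 t)\<^sup>2"
    proof -
      have "(1 - 1 / z1 t)\<^sup>2 = (1 - z1 t)\<^sup>2 / (z1 t)\<^sup>2"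
        using z1n by (simp add: field_simps power2_eq_square)
      then show ?thesis by (simp add: power_divide)
    qed
    also have "\<dots> = z2 t * (1 - z1 t) / ((1 - z2 t)\<^sup>2 * (z1 t)\<^sup>2)"
      using z1n by (simp add: power2_eq_square mult_ac)
    finally have "exp (E2 t) = z2 t * (1 - z1 t) / ((1 - z2 t)\<^sup>2 * (z1 t)\<^sup>2)" .
    then have "exp (E2 t) = 1" unfolding curve using z1n z2n[of t] by simp
    then have "E2 t = 2 * of_real pi * \<i>" using near[OF t] by (intro exp_eq_1_near) auto
    with 1 show ?thesis
      using Im1 Im2[of t] by (simp add: gluing_solutions_def gluing_equations_def E1_def E2_def)
  qed
  define p where "p s = (z1 (e / 2 * s), z2 (e / 2 * s))" for s
  have small: "\<bar>e / 2 * s\<bar> < e" if "s \<in> {0..1}" for s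
  proof -
    have "\<bar>e / 2 * s\<bar> = e / 2 * s" using e that by simp
    also have "\<dots> \<le> e / 2 * 1" using e that by (intro mult_left_mono) auto
    finally show ?thesis using e by simp
  qed
  have "isCont (\<lambda>s. z1 (e / 2 * s)) s" if "s \<in> {0..1}" for s
  proof -
    have "D (e / 2 * s) \<notin> \<real>\<^sub>\<le>\<^sub>0" using near[OF small[OF that]] by (intro nonpos) auto
    then have "isCont z1 (e / 2 * s)" by (rule contz1)
    moreover have "isCont (\<lambda>s. e / 2 * s) s" by (intro continuous_intros)
    ultimately show ?thesis using isCont_o2[of s "\<lambda>s. e / 2 * s" z1] by blast
  qed
  then have "continuous_on {0..1} (\<lambda>s. z1 (e / 2 * s))"
    by (intro continuous_at_imp_continuous_on) blast
  moreover have "continuous_on {0..1} (\<lambda>s. z2 (e / 2 * s))"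
    unfolding z2_def by (intro continuous_intros)
  ultimately have "continuous_on {0..1} p"
    unfolding p_def by (rule continuous_on_Pair)
  moreover have "inj_on p {0..1}"
    using e by (auto simp: inj_on_def p_def z2_def)
  ultimately have "arc p" by (simp add: arc_def path_def)
  moreover have "path_image p \<subseteq> gluing_solutions"
    using sol small by (auto simp: path_image_def p_def)
  moreover have "pathstart p = complete_point"
    by (simp add: pathstart_def p_def z10 z20 complete_point_eq)
  ultimately show ?thesis by blast
qed


section \<open>Normal forms in the tessellation by ideal tetrahedra\<close>

text \<open>Newman's lemma, by Noetherian induction on the common source.\<close>

lemma newman:
  assumes wf: "wf (r\<inverse>)"
    and loc: "\<And>a b c. (a, b) \<in> r \<Longrightarrow> (a, c) \<in> r \<Longrightarrow> \<exists>d. (b, d) \<in> r\<^sup>* \<and> (c, d) \<in> r\<^sup>*"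
  shows "(a, b) \<in> r\<^sup>* \<Longrightarrow> (a, c) \<in> r\<^sup>* \<Longrightarrow> \<exists>d. (b, d) \<in> r\<^sup>* \<and> (c, d) \<in> r\<^sup>*"
proof (induction a arbitrary: b c rule: wf_induct_rule[OF wf])
  case (1 a)
  show ?case
  proof (cases "a = b \<or> a = c")
    case True
    then show ?thesis using 1(2,3) by blast
  next
    case False
    then obtain b' c' where b': "(a, b') \<in> r" "(b', b) \<in> r\<^sup>*" and c': "(a, c') \<in> r" "(c', c) \<in> r\<^sup>*"
      by (metis 1(2,3) converse_rtranclE)
    obtain e where e: "(b', e) \<in> r\<^sup>*" "(c', e) \<in> r\<^sup>*" using loc b'(1) c'(1) by blast
    obtain p where p: "(b, p) \<in> r\<^sup>*" "(e, p) \<in> r\<^sup>*" using 1(1) b' e(1) by blast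
    obtain q where "(p, q) \<in> r\<^sup>*" "(c, q) \<in> r\<^sup>*"
      using 1(1)[of c' p c] c' e(2) p(2) by (meson converse_iff rtrancl_trans)
    then show ?thesis using p(1) by (meson rtrancl_trans)
  qed
qed

lemma newman_church_rosser:
  assumes wf: "wf (r\<inverse>)"
    and loc: "\<And>a b c. (a, b) \<in> r \<Longrightarrow> (a, c) \<in> r \<Longrightarrow> \<exists>d. (b, d) \<in> r\<^sup>* \<and> (c, d) \<in> r\<^sup>*"
    and "(a, b) \<in> (r \<union> r\<inverse>)\<^sup>*"
  shows "\<exists>d. (a, d) \<in> r\<^sup>* \<and> (b, d) \<in> r\<^sup>*"
  using assms(3)
proof (induction rule: rtrancl_induct)
  case base
  then show ?case by blast
next
  case (step b c)
  then obtain d where d: "(a, d) \<in> r\<^sup>*" "(b, d) \<in> r\<^sup>*" by blast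
  from step(2) show ?case
  proof
    assume "(b, c) \<in> r"
    then have "\<exists>e. (d, e) \<in> r\<^sup>* \<and> (c, e) \<in> r\<^sup>*"
      using newman[of r b d c] wf loc d(2) by blast
    then obtain e where "(d, e) \<in> r\<^sup>*" "(c, e) \<in> r\<^sup>*" by blast
    then show ?thesis using d(1) by (meson rtrancl_trans)
  next
    assume "(b, c) \<in> r\<inverse>"
    then show ?thesis using d by (meson converse_iff converse_rtrancl_into_rtrancl)
  qed
qed

text \<open>The quadruple \<open>(a, b, c, d)\<close> is the Hermitian form on \<open>\<complex>\<^sup>2\<close> with value
\<open>a \<bar>p\<bar>\<^sup>2 + d \<bar>q\<bar>\<^sup>2 + b m + c n\<close> at \<open>(p, q)\<close>, where \<open>cnj p * q = m + n \<omega>\<close> with real \<open>m\<close>, \<open>n\<close> and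
\<open>\<omega> = e\<^sup>i\<^sup>\<pi>\<^sup>/\<^sup>3\<close>.  Up to positive multiples, the positive definite forms are the points of hyperbolic space.\<close>

type_synonym form = "int \<times> int \<times> int \<times> int"

text \<open>Pulling a form back along the matrices of \<open>x\<close>, \<open>y\<close> (flag \<open>True\<close>) and their inverses at the complete
structure, \<open>x(p, q) = (p - q, q)\<close> and \<open>y(p, q) = (p, q - \<omega> p)\<close>.\<close>

fun act :: "generator \<Rightarrow> bool \<Rightarrow> form \<Rightarrow> form" where
  "act GX True (a, b, c, d) = (a, b - 2 * a, c - a, a + d - b)"
| "act GX False (a, b, c, d) = (a, b + 2 * a, c + a, a + d + b)"
| "act GY True (a, b, c, d) = (a + d - c, b - d, c - 2 * d, d)"
| "act GY False (a, b, c, d) = (a + d + c, b + d, c + 2 * d, d)"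

lemma act_inverse [simp]: "act s (\<not> e) (act s e q) = q" "act s e (act s (\<not> e) q) = q"
  by (cases q; cases s; cases e; simp)+

text \<open>The inequalities express positive definiteness.  The congruence is invariant under the action and, by
way of the height modulo 3, tells the two kinds of tetrahedra apart.\<close>

fun admissible :: "form \<Rightarrow> bool" where
  "admissible (a, b, c, d) \<longleftrightarrow>
     a > 0 \<and> d > 0 \<and> b\<^sup>2 - b * c + c\<^sup>2 < 3 * a * d \<and> (b + c) mod 3 = 2"

lemma eisenstein_norm_nonneg: "(b\<^sup>2 - b * c + c\<^sup>2 :: int) \<ge> 0"
proof -
  have "4 * (b\<^sup>2 - b * c + c\<^sup>2) = (2 * b - c)\<^sup>2 + 3 * c\<^sup>2" by (simp add: power2_eq_square algebra_simps)
  then show ?thesis by (smt (verit) zero_le_power2)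
qed

text \<open>Each generator fixes one diagonal coefficient, and the discriminant is invariant, which forces the
other diagonal coefficient to stay positive.\<close>

lemma admissible_act: assumes "admissible q" shows "admissible (act s e q)"
proof -
  obtain a b c d where q: "q = (a, b, c, d)" by (cases q)
  have *: "a > 0" "d > 0" "b\<^sup>2 - b * c + c\<^sup>2 < 3 * a * d" "(b + c) mod 3 = 2" using assms q by auto
  have pos: "v > 0" if "u > 0" "b'\<^sup>2 - b' * c' + c'\<^sup>2 < 3 * u * v" for u v b' c' :: int
    using that eisenstein_norm_nonneg[of b' c'] by (smt (verit) zero_less_mult_iff)
  have mod3: "(b + c + 3 * k) mod 3 = 2" for k using *(4) by presburger
  show ?thesis
  proof (cases s)
    case GX
    define t where "t = (if e then 1 else - 1 :: int)"
    have "act s e q = (a, b - 2 * t * a, c - t * a, a + d - t * b)" by (simp add: GX q t_def)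
    moreover have disc: "(b - 2 * t * a)\<^sup>2 - (b - 2 * t * a) * (c - t * a) + (c - t * a)\<^sup>2
        < 3 * a * (a + d - t * b)"
      using *(3) by (cases e) (simp_all add: t_def power2_eq_square algebra_simps)
    moreover have "(b - 2 * t * a) + (c - t * a) = b + c + 3 * (- t * a)" by simp
    ultimately show ?thesis using pos[OF *(1) disc] *(1) mod3 by (metis admissible.simps)
  next
    case GY
    define t where "t = (if e then 1 else - 1 :: int)"
    have "act s e q = (a + d - t * c, b - t * d, c - 2 * t * d, d)" by (simp add: GY q t_def)
    moreover have disc: "(b - t * d)\<^sup>2 - (b - t * d) * (c - 2 * t * d) + (c - 2 * t * d)\<^sup>2
        < 3 * d * (a + d - t * c)"
      using *(3) by (cases e) (simp_all add: t_def power2_eq_square algebra_simps)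
    moreover have "(b - t * d) + (c - 2 * t * d) = b + c + 3 * (- t * d)" by simp
    moreover have "3 * d * (a + d - t * c) = 3 * (a + d - t * c) * d" by simp
    ultimately show ?thesis using pos[OF *(2) disc] *(2) mod3 by (metis admissible.simps)
  qed
qed

text \<open>The sum of the values of the form at four vectors representing the vertices of an ideal tetrahedron:
\<open>(1, 0)\<close>, \<open>(0, 1)\<close>, \<open>(1, -1)\<close>, \<open>(1, -\<omega>)\<close>, that is \<open>\<infinity>, 0, -1, \<omega>\<^sup>2\<close>, for the flag \<open>False\<close>; and
\<open>(1, 0)\<close>, \<open>(0, 1)\<close>, \<open>(1, -1)\<close>, \<open>(1, \<omega> - 1)\<close>, that is \<open>\<infinity>, 0, -1, -\<omega>\<close>, for the flag \<open>True\<close>.\<close>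

fun height :: "form \<times> bool \<Rightarrow> int" where
  "height ((a, b, c, d), False) = 3 * a - b - c + 3 * d"
| "height ((a, b, c, d), True) = 3 * a - 2 * b + c + 3 * d"

lemma height_pos: assumes "admissible q" shows "height (q, i) > 0"
proof -
  obtain a b c d where q: "q = (a, b, c, d)" by (cases q)
  have *: "a > 0" "d > 0" "b\<^sup>2 - b * c + c\<^sup>2 < 3 * a * d" using assms q by auto
  have bound: "t < 3 * (a + d)" if "t\<^sup>2 \<le> 4 * (b\<^sup>2 - b * c + c\<^sup>2)" for t
  proof (rule ccontr)
    assume "\<not> t < 3 * (a + d)"
    then have "(3 * (a + d))\<^sup>2 \<le> t\<^sup>2" using * by (intro power_mono) auto
    moreover have "4 * (3 * a * d) \<le> (3 * (a + d))\<^sup>2"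
      using * mult_pos_pos[of a d] zero_le_power2[of a] zero_le_power2[of d]
      by (simp add: power2_eq_square algebra_simps)
    moreover have "4 * (b\<^sup>2 - b * c + c\<^sup>2) < 4 * (3 * a * d)" using *(3) by simp
    ultimately show False using that by (meson leD le_less_trans order_trans)
  qed
  have "(b + c)\<^sup>2 \<le> 4 * (b\<^sup>2 - b * c + c\<^sup>2)"
    using zero_le_power2[of "b - c"] by (simp add: power2_eq_square algebra_simps)
  moreover have "(2 * b - c)\<^sup>2 \<le> 4 * (b\<^sup>2 - b * c + c\<^sup>2)"
    using zero_le_power2[of c] by (simp add: power2_eq_square algebra_simps)
  ultimately show ?thesis using bound[of "b + c"] bound[of "2 * b - c"] by (cases i) (auto simp: q)
qed

lemma height_mod_3: "admissible q \<Longrightarrow> height (q, i) mod 3 = (if i then 2 else 1)"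
  by (cases q; cases i) (simp; presburger)+

text \<open>The faces of the first tetrahedron opposite to \<open>0\<close>, \<open>\<omega>\<^sup>2\<close>, \<open>\<infinity>\<close> and \<open>-1\<close>.  Each is glued to a face of
the second tetrahedron, and both faces carry the same name.\<close>

datatype face = FA | FB | FC | FD

text \<open>Passing through a face replaces the form by its pullback along a group element and switches the
tetrahedron.  The group elements, in the order of the faces, are \<open>x y x\<^sup>-\<^sup>1\<close>, \<open>1\<close>, \<open>y\<close> and \<open>y x\<^sup>-\<^sup>1\<close>
starting from the first tetrahedron, and their inverses starting from the second.\<close>

fun cross :: "face \<Rightarrow> form \<times> bool \<Rightarrow> form \<times> bool" where
  "cross FA (q, False) = (act GX False (act GY True (act GX True q)), True)"
| "cross FB (q, False) = (q, True)"
| "cross FC (q, False) = (act GY True q, True)"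
| "cross FD (q, False) = (act GX False (act GY True q), True)"
| "cross FA (q, True) = (act GX False (act GY False (act GX True q)), False)"
| "cross FB (q, True) = (q, False)"
| "cross FC (q, True) = (act GY False q, False)"
| "cross FD (q, True) = (act GY False (act GX True q), False)"

text \<open>Two faces \<open>f\<close>, \<open>g\<close> of a tetrahedron share an edge.  After crossing \<open>f\<close>, the path around that edge
continues through the two faces \<open>turn i f g\<close> and thereby reaches the tetrahedron diametrically
opposite; the path that starts with \<open>g\<close> reaches it from the other side.\<close>

fun turn :: "bool \<Rightarrow> face \<Rightarrow> face \<Rightarrow> face \<times> face" where
  "turn False FA FB = (FD, FB)" | "turn False FB FA = (FD, FC)"
| "turn False FA FC = (FB, FC)" | "turn False FC FA = (FD, FA)"
| "turn False FA FD = (FC, FB)" | "turn False FD FA = (FC, FA)"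
| "turn False FB FC = (FA, FC)" | "turn False FC FB = (FA, FD)"
| "turn False FB FD = (FC, FD)" | "turn False FD FB = (FA, FB)"
| "turn False FC FD = (FB, FD)" | "turn False FD FC = (FB, FA)"
| "turn True FA FB = (FC, FD)" | "turn True FB FA = (FC, FA)"
| "turn True FA FC = (FD, FC)" | "turn True FC FA = (FB, FA)"
| "turn True FA FD = (FB, FD)" | "turn True FD FA = (FB, FC)"
| "turn True FB FC = (FD, FA)" | "turn True FC FB = (FD, FB)"
| "turn True FB FD = (FA, FD)" | "turn True FD FB = (FC, FB)"
| "turn True FC FD = (FA, FB)" | "turn True FD FC = (FA, FC)"
| "turn _ f _ = (f, f)"

text \<open>Number the heights around the edge \<open>t\<^sub>0, \<dots>, t\<^sub>5\<close> and measure them from their mean.  The vertices other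
than the ends \<open>v\<close>, \<open>w\<close> of the edge are \<open>v + \<omega>\<^sup>j w\<close>, whence \<open>t\<^sub>j\<^sub>+\<^sub>1 = t\<^sub>j + t\<^sub>j\<^sub>+\<^sub>2\<close> and \<open>t\<^sub>j\<^sub>+\<^sub>3 = -t\<^sub>j\<close>.  If
\<open>t\<^sub>1, t\<^sub>5 < t\<^sub>0 = t\<^sub>1 + t\<^sub>5\<close> then \<open>t\<^sub>1 > 0 > t\<^sub>2 = -t\<^sub>5 > t\<^sub>3 = -t\<^sub>0\<close>, and symmetrically for \<open>t\<^sub>4\<close>.\<close>

lemma turn_descends:
  assumes "f \<noteq> g" "turn i f g = (f2, f3)"
    "height (cross f (q, i)) < height (q, i)" "height (cross g (q, i)) < height (q, i)"
  shows "height (cross f2 (cross f (q, i))) < height (cross f (q, i))"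
    "height (cross f3 (cross f2 (cross f (q, i)))) < height (cross f2 (cross f (q, i)))"
  using assms by (cases q; cases i; cases f; cases g; force)+

text \<open>The argument only needs an abstract group with the knot relation, together with the form at each
element; the base form \<open>(1, 1, 1, 1)\<close> takes the value one at all four vertices of the first
tetrahedron and is the centre of that tetrahedron.\<close>

locale figure_eight = group G for G (structure) +
  fixes x y :: 'a and Q :: "'a \<Rightarrow> form"
  assumes x_closed [simp]: "x \<in> carrier G" and y_closed [simp]: "y \<in> carrier G"
    and relation: "x \<otimes> inv y \<otimes> inv x \<otimes> y \<otimes> x = y \<otimes> x \<otimes> inv y \<otimes> inv x \<otimes> y"
    and generated: "carrier G \<subseteq> generate G {x, y}"
    and Q_x: "g \<in> carrier G \<Longrightarrow> Q (g \<otimes> x) = act GX True (Q g)"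
    and Q_y: "g \<in> carrier G \<Longrightarrow> Q (g \<otimes> y) = act GY True (Q g)"
    and Q_one: "Q \<one> = (1, 1, 1, 1)"
begin

lemma cancel_left [simp]:
  assumes "g \<in> carrier G" "h \<in> carrier G"
  shows "inv g \<otimes> (g \<otimes> h) = h" "g \<otimes> (inv g \<otimes> h) = h"
  using assms by (simp_all flip: m_assoc)

lemma Q_inv:
  assumes "g \<in> carrier G"
  shows "Q (g \<otimes> inv x) = act GX False (Q g)" "Q (g \<otimes> inv y) = act GY False (Q g)"
proof -
  have "act GX True (Q (g \<otimes> inv x)) = Q g" "act GY True (Q (g \<otimes> inv y)) = Q g"
    using assms by (simp_all add: m_assoc flip: Q_x Q_y)
  then show "Q (g \<otimes> inv x) = act GX False (Q g)" "Q (g \<otimes> inv y) = act GY False (Q g)"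
    by (metis act_inverse(1))+
qed

text \<open>The tetrahedra \<open>g T\<close> and \<open>g (glue f) T'\<close> share the face \<open>f\<close>, where \<open>T\<close>, \<open>T'\<close> are the two base tetrahedra.\<close>

fun glue :: "face \<Rightarrow> 'a" where
  "glue FA = x \<otimes> y \<otimes> inv x"
| "glue FB = \<one>"
| "glue FC = y"
| "glue FD = y \<otimes> inv x"

lemma glue_closed [simp]: "glue f \<in> carrier G"
  by (cases f) auto

fun nbr :: "face \<Rightarrow> 'a \<times> bool \<Rightarrow> 'a \<times> bool" where
  "nbr f (g, False) = (g \<otimes> glue f, True)"
| "nbr f (g, True) = (g \<otimes> inv (glue f), False)"

definition ht :: "'a \<times> bool \<Rightarrow> int" where
  "ht v = height (Q (fst v), snd v)"

lemma fst_nbr [simp]: "fst v \<in> carrier G \<Longrightarrow> fst (nbr f v) \<in> carrier G"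
  by (cases v; cases "snd v") auto

lemma nbr_nbr [simp]: "fst v \<in> carrier G \<Longrightarrow> nbr f (nbr f v) = v"
  by (cases v; cases "snd v") (auto simp: m_assoc)

lemma Q_nbr:
  "fst v \<in> carrier G \<Longrightarrow> (Q (fst (nbr f v)), snd (nbr f v)) = cross f (Q (fst v), snd v)"
  by (cases v; cases "snd v"; cases f) (auto simp: inv_mult_group Q_inv Q_x Q_y simp flip: m_assoc)

lemma ht_nbr: "fst v \<in> carrier G \<Longrightarrow> ht (nbr f v) = height (cross f (Q (fst v), snd v))"
  by (simp add: ht_def flip: Q_nbr)

text \<open>The relators of the two forms of the knot relation are conjugate.  Going around the edges of the
tessellation produces both forms.\<close>

lemma relation': "y \<otimes> x \<otimes> inv y \<otimes> x \<otimes> y = x \<otimes> y \<otimes> inv x \<otimes> y \<otimes> x"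
proof -
  have "y \<otimes> x \<otimes> inv y \<otimes> x \<otimes> y =
     x \<otimes> y \<otimes> inv x \<otimes> (x \<otimes> inv y \<otimes> inv x \<otimes> y \<otimes> x) \<otimes> inv (y \<otimes> x \<otimes> inv y \<otimes> inv x \<otimes> y)
       \<otimes> inv (x \<otimes> y \<otimes> inv x) \<otimes> (x \<otimes> y \<otimes> inv x \<otimes> y \<otimes> x)"
    by (simp add: m_assoc inv_mult_group)
  also have "\<dots> = x \<otimes> y \<otimes> inv x \<otimes> y \<otimes> x"
    unfolding relation by (simp add: m_assoc inv_mult_group)
  finally show ?thesis .
qed

lemma edge_relations:
  "y \<otimes> (x \<otimes> (inv y \<otimes> (x \<otimes> (y \<otimes> inv x)))) = x \<otimes> (y \<otimes> (inv x \<otimes> y))"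
  "y \<otimes> (inv x \<otimes> (inv y \<otimes> (x \<otimes> (y \<otimes> inv x)))) = x \<otimes> (y \<otimes> (inv x \<otimes> inv y))"
  "y \<otimes> (x \<otimes> (inv y \<otimes> (inv x \<otimes> (y \<otimes> inv x)))) = x \<otimes> (inv y \<otimes> (inv x \<otimes> y))"
  "x \<otimes> (inv y \<otimes> (inv x \<otimes> (y \<otimes> (x \<otimes> inv y)))) = y \<otimes> (x \<otimes> (inv y \<otimes> inv x))"
  "x \<otimes> (inv y \<otimes> (inv x \<otimes> (y \<otimes> (inv x \<otimes> inv y)))) = inv y \<otimes> (x \<otimes> (inv y \<otimes> inv x))"
  "x \<otimes> (inv y \<otimes> (x \<otimes> (y \<otimes> (inv x \<otimes> inv y)))) = inv y \<otimes> (x \<otimes> (y \<otimes> inv x))"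
proof -
  show "y \<otimes> (x \<otimes> (inv y \<otimes> (x \<otimes> (y \<otimes> inv x)))) = x \<otimes> (y \<otimes> (inv x \<otimes> y))"
    using arg_cong[OF relation', of "\<lambda>g. g \<otimes> inv x"] by (simp add: m_assoc inv_mult_group)
  show "y \<otimes> (inv x \<otimes> (inv y \<otimes> (x \<otimes> (y \<otimes> inv x)))) = x \<otimes> (y \<otimes> (inv x \<otimes> inv y))"
    using arg_cong[OF relation, of "\<lambda>g. y \<otimes> inv g"] by (simp add: m_assoc inv_mult_group)
  show "y \<otimes> (x \<otimes> (inv y \<otimes> (inv x \<otimes> (y \<otimes> inv x)))) = x \<otimes> (inv y \<otimes> (inv x \<otimes> y))"
    using arg_cong[OF relation, of "\<lambda>g. g \<otimes> inv x"] by (simp add: m_assoc inv_mult_group)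
  show "x \<otimes> (inv y \<otimes> (inv x \<otimes> (y \<otimes> (x \<otimes> inv y)))) = y \<otimes> (x \<otimes> (inv y \<otimes> inv x))"
    using arg_cong[OF relation, of "\<lambda>g. g \<otimes> inv y"] by (simp add: m_assoc inv_mult_group)
  show "x \<otimes> (inv y \<otimes> (inv x \<otimes> (y \<otimes> (inv x \<otimes> inv y)))) = inv y \<otimes> (x \<otimes> (inv y \<otimes> inv x))"
    using arg_cong[OF relation, of "\<lambda>g. inv y \<otimes> g \<otimes> inv x \<otimes> inv y"] by (simp add: m_assoc inv_mult_group)
  show "x \<otimes> (inv y \<otimes> (x \<otimes> (y \<otimes> (inv x \<otimes> inv y)))) = inv y \<otimes> (x \<otimes> (y \<otimes> inv x))"
    using arg_cong[OF relation', of "\<lambda>g. inv y \<otimes> g \<otimes> inv x \<otimes> inv y"] by (simp add: m_assoc inv_mult_group)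
qed

text \<open>The heart of the matter: walking once around an edge gives the trivial element of the abstract group,
and not only of its image in PSL(2,C).\<close>

lemma turn_meets:
  assumes "fst v \<in> carrier G" "f \<noteq> g" "turn (snd v) f g = (f2, f3)" "turn (snd v) g f = (g2, g3)"
  shows "nbr f3 (nbr f2 (nbr f v)) = nbr g3 (nbr g2 (nbr g v))"
  using assms
  by (cases v; cases "snd v"; cases f; cases g) (auto simp: m_assoc inv_mult_group edge_relations)

definition edges :: "(('a \<times> bool) \<times> ('a \<times> bool)) set" where
  "edges = {(v, nbr f v) |v f. fst v \<in> carrier G}"

lemma edges_sym: "(u, v) \<in> edges \<Longrightarrow> (v, u) \<in> edges"
  unfolding edges_def by clarify (metis fst_nbr nbr_nbr)

lemma connected_one:
  assumes "g \<in> carrier G" "h \<in> carrier G"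
  shows "((g, False), (g \<otimes> h, False)) \<in> edges\<^sup>*"
proof -
  have path: "((g, False), (g \<otimes> glue f \<otimes> inv (glue f'), False)) \<in> edges\<^sup>*"
    if "g \<in> carrier G" for g f f'
  proof -
    have "((g, False), nbr f (g, False)) \<in> edges" "(nbr f (g, False), nbr f' (nbr f (g, False))) \<in> edges"
      unfolding edges_def using that by (fastforce simp del: nbr.simps)+
    then show ?thesis by auto
  qed
  have gens: "((g, False), (g \<otimes> z, False)) \<in> edges\<^sup>*" if "g \<in> carrier G" "z \<in> {x, y}" for g z
  proof (cases "z = y")
    case True
    then show ?thesis using path[of g FC FB] that by simp
  next
    case False
    have "((g, False), (g \<otimes> x \<otimes> inv y, False)) \<in> edges\<^sup>*"
      "((g \<otimes> x \<otimes> inv y, False), (g \<otimes> x, False)) \<in> edges\<^sup>*"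
      using path[of g FB FD] path[of "g \<otimes> x \<otimes> inv y" FC FB] that(1)
      by (simp_all add: inv_mult_group m_assoc)
    then show ?thesis using False that(2) by (metis insertE rtrancl_trans singletonD)
  qed
  have sym: "sym (edges\<^sup>*)" by (rule sym_rtrancl, rule symI, erule edges_sym)
  have "h \<in> generate G {x, y}" using assms(2) generated by blast
  then show ?thesis using assms(1)
  proof (induction arbitrary: g rule: generate.induct)
    case one
    then show ?case by simp
  next
    case (incl z)
    then show ?case using gens by blast
  next
    case (inv z)
    then have "z \<in> carrier G" by auto
    with inv have "((g \<otimes> inv z, False), (g, False)) \<in> edges\<^sup>*"
      using gens[of "g \<otimes> inv z" z] by (simp add: m_assoc)
    then show ?case using sym by (meson symD)
  next
    case (eng h1 h2)
    have "generate G {x, y} \<subseteq> carrier G" by (rule generate_incl) auto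
    with eng(1,2) have c: "h1 \<in> carrier G" "h2 \<in> carrier G" by auto
    have "((g, False), (g \<otimes> h1, False)) \<in> edges\<^sup>*" "((g \<otimes> h1, False), (g \<otimes> h1 \<otimes> h2, False)) \<in> edges\<^sup>*"
      using eng c by auto
    then show ?case using c eng(5) by (simp add: m_assoc)
  qed
qed

lemma admissible_Q:
  assumes "g \<in> carrier G"
  shows "admissible (Q g)"
proof -
  have "admissible (Q (fst v))" if "((\<one>, False), v) \<in> edges\<^sup>*" for v
    using that
  proof (induction rule: rtrancl_induct)
    case base
    then show ?case by (simp add: Q_one)
  next
    case (step u v)
    then obtain f where "v = nbr f u" "fst u \<in> carrier G" by (auto simp: edges_def)
    then have "Q (fst v) = fst (cross f (Q (fst u), snd u))" by (metis Q_nbr fst_conv)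
    moreover have "admissible (fst (cross f (Q (fst u), snd u)))"
      using step.IH by (cases "snd u"; cases f) (auto simp: admissible_act)
    ultimately show ?case by simp
  qed
  from this[OF connected_one[OF one_closed assms]] show ?thesis using assms by simp
qed

definition steps :: "(('a \<times> bool) \<times> ('a \<times> bool)) set" where
  "steps = {(u, v) \<in> edges. ht v < ht u}"

text \<open>Adjacent vertices belong to different kinds of tetrahedra, so their heights differ modulo 3 and every
edge is oriented downwards in exactly one direction.\<close>

lemma edges_steps: "edges \<subseteq> steps \<union> steps\<inverse>"
proof (rule subrelI)
  fix v w assume "(v, w) \<in> edges"
  then obtain g i h j where v: "v = (g, i)" and w: "w = (h, j)" and e: "((g, i), (h, j)) \<in> edges"
    by (cases v, cases w) auto
  have "g \<in> carrier G" "h \<in> carrier G" "i \<noteq> j" using e by (cases i; auto simp: edges_def)+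
  then have "ht (g, i) mod 3 \<noteq> ht (h, j) mod 3"
    using height_mod_3 admissible_Q by (simp add: ht_def)
  then have "ht (g, i) \<noteq> ht (h, j)" by auto
  then show "(v, w) \<in> steps \<union> steps\<inverse>" using e edges_sym by (auto simp: steps_def v w)
qed

lemma wf_steps: "wf (steps\<inverse>)"
proof (rule wf_subset)
  show "steps\<inverse> \<subseteq> Wellfounded.measure (\<lambda>v. nat (ht v))"
    using height_pos[OF admissible_Q] by (auto simp: steps_def edges_def ht_def zless_nat_conj)
qed auto

lemma steps_locally_confluent:
  assumes "(v, u) \<in> steps" "(v, w) \<in> steps"
  shows "\<exists>z. (u, z) \<in> steps\<^sup>* \<and> (w, z) \<in> steps\<^sup>*"
proof -
  obtain f g where v: "fst v \<in> carrier G" and u: "u = nbr f v" and w: "w = nbr g v"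
    and lower: "ht (nbr f v) < ht v" "ht (nbr g v) < ht v"
    using assms by (auto simp: steps_def edges_def)
  have descend: "(nbr f v, nbr f3 (nbr f2 (nbr f v))) \<in> steps\<^sup>*"
    if "f \<noteq> g" "turn (snd v) f g = (f2, f3)" "ht (nbr f v) < ht v" "ht (nbr g v) < ht v" for f g f2 f3
  proof -
    note d = turn_descends[OF that(1,2), of "Q (fst v)"]
    have "ht v = height (Q (fst v), snd v)" by (simp add: ht_def)
    then have "ht (nbr f2 (nbr f v)) < ht (nbr f v)"
      "ht (nbr f3 (nbr f2 (nbr f v))) < ht (nbr f2 (nbr f v))"
      using d that(3,4) v by (simp_all add: ht_nbr Q_nbr)
    then have "(nbr f v, nbr f2 (nbr f v)) \<in> steps"
      "(nbr f2 (nbr f v), nbr f3 (nbr f2 (nbr f v))) \<in> steps"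
      using v fst_nbr unfolding steps_def edges_def by blast+
    then show ?thesis by (meson r_into_rtrancl rtrancl_into_rtrancl)
  qed
  show ?thesis
  proof (cases "f = g")
    case False
    obtain f2 f3 g2 g3 where t: "turn (snd v) f g = (f2, f3)" "turn (snd v) g f = (g2, g3)"
      by (metis surj_pair)
    show ?thesis
      using descend[OF False t(1) lower] descend[OF False[symmetric] t(2) lower(2,1)]
        turn_meets[OF v False t] unfolding u w by metis
  qed (use u w in blast)
qed

text \<open>Being a local minimum only depends on the form, so \<open>g\<close> and \<open>\<one>\<close> both give local minima.\<close>

theorem faithful:
  assumes g: "g \<in> carrier G" and Qg: "Q g = (1, 1, 1, 1)"
  shows "g = \<one>"
proof -
  have normal: "((h, False), v) \<notin> steps" if "Q h = (1, 1, 1, 1)" "h \<in> carrier G" for h v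
  proof
    assume "((h, False), v) \<in> steps"
    then obtain f where "ht (nbr f (h, False)) < ht (h, False)"
      by (auto simp: steps_def edges_def)
    then have "height (cross f ((1, 1, 1, 1), False)) < height ((1, 1, 1, 1), False)"
      using ht_nbr[of "(h, False)" f] that by (simp add: ht_def)
    then show False by (cases f) simp_all
  qed
  have "((\<one>, False), (g, False)) \<in> edges\<^sup>*" using connected_one[OF one_closed g] g by simp
  then have "((\<one>, False), (g, False)) \<in> (steps \<union> steps\<inverse>)\<^sup>*"
    using edges_steps rtrancl_mono by blast
  then have "\<exists>v. ((\<one>, False), v) \<in> steps\<^sup>* \<and> ((g, False), v) \<in> steps\<^sup>*"
    using newman_church_rosser[of steps] wf_steps steps_locally_confluent by blast
  then obtain v where "((\<one>, False), v) \<in> steps\<^sup>*" "((g, False), v) \<in> steps\<^sup>*" by blast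
  then have "v = (\<one>, False)" "v = (g, False)"
    using normal[OF Q_one one_closed] normal[OF Qg g] by (metis converse_rtranclE)+
  then show ?thesis by simp
qed

end


section \<open>Faithfulness and discreteness of the complete holonomy\<close>

text \<open>The pairing of a form with a Hermitian matrix given by its Klein coordinates: \<open>vv\<^sup>*\<close> is paired to the
value of the form at \<open>v\<close>.\<close>

fun coord :: "form \<Rightarrow> real^4 \<Rightarrow> real" where
  "coord (a, b, c, d) u = a * (u$4 - u$3) / 2 + d * (u$4 + u$3) / 8
     + b * (u$1 / 4 + sqrt 3 * u$2 / 12) - c * (sqrt 3 * u$2 / 6)"

lemma rho_matrix_omega:
  "rho_matrix omega omega GX = vector [vector [1, - 1], vector [0, 1]]"
  "rho_matrix omega omega GY = vector [vector [1, 0], vector [- omega, 1]]"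
proof -
  have "omega * (1 - omega) = 1" using omega_square by (simp add: power2_eq_square algebra_simps)
  then show "rho_matrix omega omega GX = vector [vector [1, - 1], vector [0, 1]]"
    "rho_matrix omega omega GY = vector [vector [1, 0], vector [- omega, 1]]"
    by (simp_all add: rho_matrix_def)
qed

lemma omega_solution: "(omega, omega) \<in> gluing_solutions"
  using complete_point_in_gluing_solutions by (simp add: complete_point_eq)

lemma coord_act_generator:
  "coord (act s True q) u = coord q (lorentz_rep (rho_matrix omega omega s) *v u)"
proof -
  obtain a b c d where q: "q = (a, b, c, d)" by (cases q)
  have r3: "sqrt 3 * (sqrt 3 * t) = 3 * t" for t :: real
    by (simp flip: mult.assoc)
  show ?thesis
    by (cases s; simp add: q lorentz_rep_apply rho_matrix_omega klein_def herm_def)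
      (simp_all add: field_simps r3)
qed

lemma coord_act:
  "coord (act s b q) u =
    coord q (lorentz_rep (if b then rho_matrix omega omega s else inv\<^bsub>SL2C\<^esub> (rho_matrix omega omega s)) *v u)"
proof (cases b)
  case True
  then show ?thesis by (simp add: coord_act_generator)
next
  case False
  let ?A = "rho_matrix omega omega s"
  interpret S: group SL2C by (rule group_SL2C)
  have "?A ** inv\<^bsub>SL2C\<^esub> ?A = mat 1"
    using S.r_inv[OF rho_matrix_closed[OF omega_solution]] by (simp add: SL2C_def)
  then have "lorentz_rep ?A *v (lorentz_rep (inv\<^bsub>SL2C\<^esub> ?A) *v u) = u"
    by (metis lorentz_rep_mult lorentz_rep_one matrix_vector_mul_assoc matrix_vector_mul_lid)
  then have "coord (act s True (act s False q)) (lorentz_rep (inv\<^bsub>SL2C\<^esub> ?A) *v u) = coord (act s False q) u"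
    by (simp add: coord_act_generator)
  then show ?thesis using False act_inverse(2)[of s True q] by simp
qed

text \<open>The letters act from left to right because pullback reverses the order of composition.\<close>

fun act_word :: "form \<Rightarrow> generator word \<Rightarrow> form" where
  "act_word q [] = q"
| "act_word q ((s, b) # w) = act_word (act s b q) w"

lemma act_word_append [simp]: "act_word q (u @ v) = act_word (act_word q u) v"
  by (induction q u rule: act_word.induct) auto

lemma coord_act_word:
  "coord (act_word q w) u = coord q (lorentz_rep (word_matrix omega omega w) *v u)"
proof (induction q w rule: act_word.induct)
  case (1 q)
  then show ?case by (simp add: word_matrix_def SL2C_def)
next
  case (2 q s b w)
  let ?A = "if b then rho_matrix omega omega s else inv\<^bsub>SL2C\<^esub> (rho_matrix omega omega s)"
  have "word_matrix omega omega ((s, b) # w) = ?A ** word_matrix omega omega w"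
    by (simp add: word_matrix_def) (simp add: SL2C_def)
  then show ?case
    using 2 by (simp add: coord_act lorentz_rep_mult flip: matrix_vector_mul_assoc)
qed

text \<open>Checked on the integral action directly, so that the form attached to an element of the knot group
is well defined independently of any representation.\<close>

lemma word_eq_act_word:
  assumes "word_eq fig8_relations u v" shows "act_word q u = act_word q v"
  using assms
proof (induction arbitrary: q)
  case (cancel s b)
  then show ?case using act_inverse by simp
next
  case (relation u v)
  then show ?case
    by (cases q) (simp add: fig8_relations_def word_a_def)
qed simp_all

definition class_form :: "generator word set \<Rightarrow> form" where
  "class_form C = act_word (1, 1, 1, 1) (SOME w. w \<in> C)"

lemma class_form_word_class: "class_form (word_class fig8_relations w) = act_word (1, 1, 1, 1) w"
proof -
  have "w \<in> word_class fig8_relations w" by (simp add: word_class_def word_eq.refl)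
  then have "(SOME v. v \<in> word_class fig8_relations w) \<in> word_class fig8_relations w" by (rule someI)
  then show ?thesis
    unfolding class_form_def word_class_def using word_eq_act_word by (metis mem_Collect_eq)
qed

lemma eval_word_fig8: "eval_word fig8_group fig8_gen w = word_class fig8_relations w"
proof -
  have eq: "fig8_gen = (\<lambda>s. word_class fig8_relations [(s, True)])" by (simp add: fun_eq_iff fig8_gen_def)
  show ?thesis unfolding eq fig8_group_def by (rule eval_word_presented_group)
qed

lemma fig8_mult_gen:
  assumes "g \<in> carrier fig8_group"
  shows "class_form (g \<otimes>\<^bsub>fig8_group\<^esub> fig8_gen s) = act s True (class_form g)"
proof -
  obtain w where "g = word_class fig8_relations w" using assms by (auto simp: carrier_fig8_group)
  then show ?thesis
    by (simp add: fig8_group_def fig8_gen_def presented_group_mult class_form_word_class)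
qed

lemma figure_eight_fig8_group:
  "figure_eight fig8_group (fig8_gen GX) (fig8_gen GY) class_form"
proof -
  interpret G: group fig8_group unfolding fig8_group_def by (rule group_presented_group)
  have gens: "fig8_gen s \<in> carrier fig8_group" for s by (simp add: carrier_fig8_group fig8_gen_def)
  show ?thesis
  proof
    show "fig8_gen GX \<in> carrier fig8_group" "fig8_gen GY \<in> carrier fig8_group" by (rule gens)+
    have "eval_word fig8_group fig8_gen (word_a @ [(GX, True)]) =
        eval_word fig8_group fig8_gen ([(GY, True)] @ word_a)"
      unfolding eval_word_fig8 word_class_eq_iff
      by (rule word_eq.relation) (simp add: fig8_relations_def)
    then show "fig8_gen GX \<otimes>\<^bsub>fig8_group\<^esub> inv\<^bsub>fig8_group\<^esub> fig8_gen GY \<otimes>\<^bsub>fig8_group\<^esub> inv\<^bsub>fig8_group\<^esub> fig8_gen GX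
          \<otimes>\<^bsub>fig8_group\<^esub> fig8_gen GY \<otimes>\<^bsub>fig8_group\<^esub> fig8_gen GX =
        fig8_gen GY \<otimes>\<^bsub>fig8_group\<^esub> fig8_gen GX \<otimes>\<^bsub>fig8_group\<^esub> inv\<^bsub>fig8_group\<^esub> fig8_gen GY
          \<otimes>\<^bsub>fig8_group\<^esub> inv\<^bsub>fig8_group\<^esub> fig8_gen GX \<otimes>\<^bsub>fig8_group\<^esub> fig8_gen GY"
      by (simp add: word_a_def gens G.m_assoc)
    have "eval_word fig8_group fig8_gen w \<in> generate fig8_group {fig8_gen GX, fig8_gen GY}" for w
    proof (induction w)
      case Nil
      then show ?case by (simp add: generate.one)
    next
      case (Cons l w)
      obtain s b where l: "l = (s, b)" by fastforce
      have m: "fig8_gen s \<in> {fig8_gen GX, fig8_gen GY}" by (cases s) auto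
      show ?case
        using generate.eng[OF generate.incl[OF m] Cons] generate.eng[OF generate.inv[OF m] Cons]
        by (simp add: l)
    qed
    then show "carrier fig8_group \<subseteq> generate fig8_group {fig8_gen GX, fig8_gen GY}"
      by (auto simp: carrier_fig8_group eval_word_fig8)
    show "class_form \<one>\<^bsub>fig8_group\<^esub> = (1, 1, 1, 1)"
      using class_form_word_class[of "[]"] by (simp add: fig8_group_def presented_group_def)
  qed (rule fig8_mult_gen, assumption)+
qed

text \<open>The four vectors are dual to the coordinates of a form.\<close>

lemma coord_eq_imp_eq:
  fixes c :: int
  assumes "\<And>u. coord (a', b', c', d') u = of_int c * coord (a, b, c0, d) u"
  shows "(a', b', c', d') = (c * a, c * b, c * c0, c * d)"
proof -
  have "coord (a', b', c', d') (vector [0, 0, -1, 1]) = c * coord (a, b, c0, d) (vector [0, 0, -1, 1])"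
    "coord (a', b', c', d') (vector [0, 0, 4, 4]) = c * coord (a, b, c0, d) (vector [0, 0, 4, 4])"
    "coord (a', b', c', d') (vector [4, 0, 0, 0]) = c * coord (a, b, c0, d) (vector [4, 0, 0, 0])"
    "coord (a', b', c', d') (vector [2, - 2 * sqrt 3, 0, 0]) = c * coord (a, b, c0, d) (vector [2, - 2 * sqrt 3, 0, 0])"
    using assms by blast+
  then have "real_of_int a' = real_of_int (c * a)" "real_of_int d' = real_of_int (c * d)"
    "real_of_int b' = real_of_int (c * b)" "real_of_int c' = real_of_int (c * c0)"
    by (simp_all add: field_simps)
  then show ?thesis by (simp only: of_int_eq_iff prod.inject)
qed

text \<open>If the image of \<open>g\<close> is the scalar \<open>c\<close>, then \<open>c\<^sup>4 = 1\<close> and the form at \<open>g\<close> is \<open>c\<close> times the base form.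
Definiteness excludes \<open>c = -1\<close>, and then \<open>g = 1\<close> since the tessellation has only one local minimum.\<close>

lemma inj_klein_holonomy_omega: "inj_on (klein_holonomy omega omega) (carrier fig8_group)"
proof -
  interpret F: figure_eight fig8_group "fig8_gen GX" "fig8_gen GY" class_form
    by (rule figure_eight_fig8_group)
  interpret h: group_hom fig8_group PGL4R "klein_holonomy omega omega"
    by (simp add: group_hom_def group_hom_axioms_def group_PGL4R F.is_group
        klein_holonomy_hom(1)[OF omega_solution])
  have "g = \<one>\<^bsub>fig8_group\<^esub>" if g: "g \<in> carrier fig8_group" and one: "klein_holonomy omega omega g = \<one>\<^bsub>PGL4R\<^esub>" for g
  proof -
    obtain w where w: "g = word_class fig8_relations w" using g by (auto simp: carrier_fig8_group)
    let ?M = "lorentz_rep (word_matrix omega omega w)"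
    have "\<one>\<^bsub>PGL4R\<^esub> = pgl_class (mat 1)"
      using group.coset_mult_one[OF group_GL4R, of scalars4] normal_imp_subgroup[OF normal_scalars4]
      by (simp add: PGL4R_def pgl_class_def GL4R_def subgroup_def)
    then have "pgl_class ?M = pgl_class (mat 1)"
      using one by (simp add: w klein_holonomy_hom[OF omega_solution])
    moreover have "?M \<in> pgl_class ?M" unfolding mem_pgl_class by (intro exI[of _ 1]) simp
    ultimately obtain c where M: "?M = c *\<^sub>R mat 1" by (auto simp: mem_pgl_class)
    have "c *\<^sub>R mat 1 = (mat c :: real^4^4)" by (simp add: mat_def vec_eq_iff)
    then have "c ^ 4 = 1"
      using det_lorentz_rep[OF det_word_matrix[OF omega_solution], of w] M
      by (simp add: det_diagonal mat_def)
    then have "c\<^sup>2 = 1" by (metis (no_types, opaque_lifting) numeral_Bit0 power2_eq_1_iff power_add power2_eq_square zero_le_power2 neg_0_le_iff_le not_one_le_zero)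
    then have c: "c = 1 \<or> c = -1" by (simp add: power2_eq_1_iff)
    define e :: int where "e = (if c = 1 then 1 else -1)"
    have ce: "c = of_int e" using c by (auto simp: e_def)
    obtain a' b' c' d' where q: "act_word (1, 1, 1, 1) w = (a', b', c', d')" by (cases "act_word (1, 1, 1, 1) w")
    have "coord (a', b', c', d') u = of_int e * coord (1, 1, 1, 1) u" for u
    proof -
      have "coord (a', b', c', d') u = coord (1, 1, 1, 1) (?M *v u)" by (simp only: coord_act_word flip: q)
      also have "?M *v u = c *\<^sub>R u" unfolding M by (simp flip: scaleR_matrix_vector_assoc)
      also have "coord (1, 1, 1, 1) (c *\<^sub>R u) = c * coord (1, 1, 1, 1) u" by (simp add: field_simps)
      finally show ?thesis by (simp add: ce)
    qed
    then have Q: "class_form g = (e, e, e, e)"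
      using coord_eq_imp_eq[of a' b' c' d' e 1 1 1 1] by (simp add: w class_form_word_class q)
    then have "e > 0" using F.admissible_Q[OF g] by simp
    then have "e = 1" by (simp add: e_def split: if_splits)
    then show ?thesis using F.faithful[OF g] Q by simp
  qed
  then show ?thesis unfolding h.inj_iff_trivial_ker by (auto simp: kernel_def)
qed

text \<open>Products \<open>L k M * L l M / sqrt \<bar>det M\<bar>\<close> are invariant under scaling and continuous, and integral on
\<open>\<Gamma>\<close>.  Hence an open set of classes isolates their values, and these determine a matrix up to sign,
that is, its class.\<close>

lemma discrete_in_PGL4R_criterion:
  fixes L :: "'k::finite \<Rightarrow> real^4^4 \<Rightarrow> real"
  assumes lin: "\<And>k. linear (L k)" and sep: "\<And>M. (\<And>k. L k M = 0) \<Longrightarrow> M = 0"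
    and \<Gamma>: "\<And>M. M \<in> \<Gamma> \<Longrightarrow> det M = 1" "\<And>M k. M \<in> \<Gamma> \<Longrightarrow> L k M \<in> \<int>"
  shows "discrete_in_PGL4R (pgl_class ` \<Gamma>)"
proof -
  have inv: "invertible M" if "M \<in> \<Gamma>" for M using \<Gamma>(1)[OF that] by (simp add: invertible_det_nz)
  have sub: "pgl_class ` \<Gamma> \<subseteq> carrier PGL4R" using inv by (auto simp: carrier_PGL4R)
  have scale: "L k (c *\<^sub>R M) = c * L k M" for k c M using lin[of k] by (simp add: linear_cmul)
  have cont: "continuous_on UNIV (L k)" for k using lin[of k] by (rule linear_continuous_on[OF linear_conv_bounded_linear[THEN iffD1]])
  have dets: "det (c *\<^sub>R M) = c ^ 4 * det M" for c and M :: "real^4^4"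
  proof -
    have "c *\<^sub>R M = mat c ** M" by (simp add: mat_mult_left vec_eq_iff)
    then show ?thesis by (simp add: det_mul det_diagonal mat_def)
  qed
  have "openin (subtopology PGL4R_topology (pgl_class ` \<Gamma>)) {pgl_class A}" if A: "A \<in> \<Gamma>" for A
  proof -
    \<comment> \<open>Multiplying by the root avoids division, and the strict inequality excludes \<open>det M = 0\<close>.\<close>
    define V where "V = (\<Inter>k. \<Inter>l. {M. \<bar>L k M * L l M - L k A * L l A * sqrt \<bar>det M\<bar>\<bar> < sqrt \<bar>det M\<bar>})"
    have "open V"
      unfolding V_def by (intro open_INT finite ballI open_Collect_less continuous_intros cont continuous_on_det)
    have Vdet: "det M \<noteq> 0" if "M \<in> V" for M
      using that by (auto simp: V_def)
    have Vscale: "c *\<^sub>R M \<in> V" if "M \<in> V" "c \<noteq> 0" for c M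
    proof -
      have "sqrt (c ^ 4) = c\<^sup>2" by (rule real_sqrt_unique) (simp_all flip: power_mult)
      then have s: "sqrt \<bar>det (c *\<^sub>R M)\<bar> = c\<^sup>2 * sqrt \<bar>det M\<bar>" by (simp add: dets abs_mult real_sqrt_mult)
      have "\<bar>L k (c *\<^sub>R M) * L l (c *\<^sub>R M) - L k A * L l A * sqrt \<bar>det (c *\<^sub>R M)\<bar>\<bar> < sqrt \<bar>det (c *\<^sub>R M)\<bar>" for k l
      proof -
        have "L k (c *\<^sub>R M) * L l (c *\<^sub>R M) - L k A * L l A * (c\<^sup>2 * sqrt \<bar>det M\<bar>) =
            c\<^sup>2 * (L k M * L l M - L k A * L l A * sqrt \<bar>det M\<bar>)"
          by (simp add: scale power2_eq_square algebra_simps)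
        then show ?thesis unfolding s using that by (simp add: abs_mult V_def)
      qed
      then show ?thesis by (simp add: V_def)
    qed
    have U: "\<Union>(pgl_class ` V) = V"
      using Vscale by (auto simp: mem_pgl_class intro!: bexI exI[of _ "1::real"])
    have "openin PGL4R_topology (pgl_class ` V)"
      unfolding openin_PGL4R U using \<open>open V\<close> Vdet by (auto simp: carrier_PGL4R invertible_det_nz)
    moreover have "pgl_class ` V \<inter> pgl_class ` \<Gamma> = {pgl_class A}"
    proof (intro equalityI subsetI)
      fix P assume "P \<in> pgl_class ` V \<inter> pgl_class ` \<Gamma>"
      then obtain M B where M: "M \<in> V" "P = pgl_class M" and B: "B \<in> \<Gamma>" "P = pgl_class B" by blast
      have "B \<in> pgl_class B" unfolding mem_pgl_class by (intro exI[of _ 1]) simp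
      then have "B \<in> V" using M B U by blast
      have eq: "L k B * L l B = L k A * L l A" for k l
      proof -
        have "\<bar>L k B * L l B - L k A * L l A\<bar> < 1" using \<open>B \<in> V\<close> \<Gamma>(1)[OF B(1)] by (simp add: V_def)
        moreover have "L k B * L l B - L k A * L l A \<in> \<int>" using \<Gamma>(2) A B(1) by auto
        ultimately show ?thesis using Ints_nonzero_abs_less1 by fastforce
      qed
      have "A \<noteq> 0" using \<Gamma>(1)[OF A] dets[of 0 A] by auto
      then obtain k where k: "L k A \<noteq> 0" using sep by blast
      define c where "c = L k B / L k A"
      have "(L k B)\<^sup>2 = (L k A)\<^sup>2" using eq[of k k] by (simp add: power2_eq_square)
      then have c: "c = 1 \<or> c = -1" using k by (auto simp: c_def power2_eq_iff)
      have "L l (B - c *\<^sub>R A) = 0" for l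
      proof -
        have "L k B \<noteq> 0" using c k by (auto simp: c_def)
        moreover have "L k B * L l B = L k B * (c * L l A)"
          using eq[of k l] c k by (auto simp: c_def field_simps)
        ultimately show ?thesis using lin[of l] by (simp add: linear_diff scale)
      qed
      then have "B = c *\<^sub>R A" using sep[of "B - c *\<^sub>R A"] by simp
      then show "P \<in> {pgl_class A}" using c B(2) pgl_class_scale[of c A] by auto
    next
      fix P assume "P \<in> {pgl_class A}"
      moreover have "A \<in> V" using \<Gamma>(1)[OF A] by (simp add: V_def)
      ultimately show "P \<in> pgl_class ` V \<inter> pgl_class ` \<Gamma>" using A by blast
    qed
    ultimately show ?thesis unfolding openin_subtopology by (intro exI[of _ "pgl_class ` V"]) simp
  qed
  moreover have "topspace (subtopology PGL4R_topology (pgl_class ` \<Gamma>)) = pgl_class ` \<Gamma>"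
    using sub by (auto simp: topspace_PGL4R)
  ultimately show ?thesis
    unfolding discrete_in_PGL4R_def by (metis (no_types, lifting) discrete_topology_unique image_iff)
qed

definition unit_form :: "4 \<Rightarrow> form" where
  "unit_form i = (if i = 1 then 1 else 0, if i = 2 then 1 else 0, if i = 3 then 1 else 0, if i = 4 then 1 else 0)"

definition lattice_basis :: "4 \<Rightarrow> real^4" where
  "lattice_basis j = (if j = 1 then vector [0, 0, -1, 1] else if j = 2 then vector [4, 0, 0, 0]
     else if j = 3 then vector [2, - 2 * sqrt 3, 0, 0] else vector [0, 0, 4, 4])"

lemma linear_coord: "linear (coord q)"
proof (cases q)
  case (fields a b c d)
  show ?thesis unfolding fields
    by (rule linearI) (simp_all add: ring_distribs add_divide_distrib diff_divide_distrib mult.left_commute)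
qed

lemma coord_lattice_basis_Ints: "coord q (lattice_basis j) \<in> \<int>"
proof -
  have "\<forall>j. coord q (lattice_basis j) \<in> \<int>"
    unfolding forall_4 by (cases q) (simp add: lattice_basis_def)
  then show ?thesis by blast
qed

lemma coord_unit_form_separates:
  assumes "\<And>i. coord (unit_form i) u = 0" shows "u = 0"
  using assms[of 1] assms[of 2] assms[of 3] assms[of 4]
  by (simp add: unit_form_def vec_eq_iff forall_4)

lemma lattice_basis_separates:
  assumes "\<And>j. M *v lattice_basis j = 0" shows "M = 0"
proof -
  have "M *v u = 0" for u :: "real^4"
  proof -
    have *: "u = ((u$4 - u$3) / 2) *\<^sub>R lattice_basis 1 + (u$1 / 4 + sqrt 3 * u$2 / 12) *\<^sub>R lattice_basis 2
       + (- (sqrt 3 * u$2 / 6)) *\<^sub>R lattice_basis 3 + ((u$4 + u$3) / 8) *\<^sub>R lattice_basis 4"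
      by (simp add: lattice_basis_def vec_eq_iff forall_4 field_simps)
    show ?thesis
      by (subst *) (simp add: matrix_vector_right_distrib matrix_vector_mult_scaleR matrix_vector_mult_diff_distrib assms)
  qed
  then show ?thesis by (metis matrix_eq matrix_vector_mult_0)
qed

text \<open>The functions \<open>L\<close> are the entries with respect to the lattice of Hermitian matrices over
\<open>Z[\<omega>]\<close>, which the group preserves.\<close>

lemma discrete_klein_holonomy_omega:
  "discrete_in_PGL4R (klein_holonomy omega omega ` carrier fig8_group)"
proof -
  define \<Gamma> where "\<Gamma> = range (\<lambda>w. lorentz_rep (word_matrix omega omega w))"
  define L :: "4 \<times> 4 \<Rightarrow> real^4^4 \<Rightarrow> real" where
    "L k M = coord (unit_form (fst k)) (M *v lattice_basis (snd k))" for k M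
  have "discrete_in_PGL4R (pgl_class ` \<Gamma>)"
  proof (rule discrete_in_PGL4R_criterion[of L])
    show "linear (L k)" for k
      using linear_coord[of "unit_form (fst k)"]
      by (auto intro!: linearI simp: L_def matrix_vector_mult_add_rdistrib linear_add linear_cmul simp flip: scaleR_matrix_vector_assoc)
    show "M = 0" if "\<And>k. L k M = 0" for M
    proof (rule lattice_basis_separates, rule coord_unit_form_separates)
      show "coord (unit_form i) (M *v lattice_basis j) = 0" for i j
        using that[of "(i, j)"] by (simp add: L_def)
    qed
    show "det M = 1" if "M \<in> \<Gamma>" for M
      using that det_lorentz_rep[OF det_word_matrix[OF omega_solution]] by (auto simp: \<Gamma>_def)
    show "L k M \<in> \<int>" if "M \<in> \<Gamma>" for M k
    proof -
      from \<open>M \<in> \<Gamma>\<close> obtain w where "M = lorentz_rep (word_matrix omega omega w)"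
        by (auto simp: \<Gamma>_def)
      then show ?thesis
        unfolding L_def by (simp only: coord_lattice_basis_Ints flip: coord_act_word)
    qed
  qed
  moreover have "klein_holonomy omega omega ` carrier fig8_group = pgl_class ` \<Gamma>"
    by (simp add: carrier_fig8_group \<Gamma>_def image_image klein_holonomy_hom[OF omega_solution])
  ultimately show ?thesis by simp
qed

theorem mainTheorem2:
  shows
    "(\<forall>z1 z2. Im z1 > 0 \<and> Im z2 > 0 \<and> gluing_equations z1 z2 \<longrightarrow>
        holonomy z1 z2 \<in> hom fig8_group PSL2C \<and>
        (\<forall>s. holonomy z1 z2 (fig8_gen s) = psl_class (rho_matrix z1 z2 s)) \<and>
        pgl_class (klein_matrix z1 z2 GX) \<in> carrier PSO31 \<and>
        represents (pgl_class (klein_matrix z1 z2 GX)) (holonomy z1 z2 (fig8_gen GX)) \<and>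
        pgl_class (klein_matrix z1 z2 GY) \<in> carrier PSO31 \<and>
        represents (pgl_class (klein_matrix z1 z2 GY)) (holonomy z1 z2 (fig8_gen GY)) \<and>
        klein_holonomy z1 z2 \<in> hom fig8_group PSO31 \<and>
        (\<forall>s. klein_holonomy z1 z2 (fig8_gen s) = pgl_class (klein_matrix z1 z2 s)) \<and>
        (\<forall>\<gamma>\<in>carrier fig8_group. represents (klein_holonomy z1 z2 \<gamma>) (holonomy z1 z2 \<gamma>)))
     \<and> (\<forall>s i j. rational_function_on gluing_solutions (\<lambda>(z1, z2). klein_matrix z1 z2 s $ i $ j))
     \<and> (\<forall>\<gamma>\<in>carrier fig8_group.
          continuous_map (top_of_set gluing_solutions) PGL4R_topology
            (\<lambda>(z1, z2). klein_holonomy z1 z2 \<gamma>))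
     \<and> complete_point \<in> gluing_solutions
     \<and> inj_on (case_prod klein_holonomy complete_point) (carrier fig8_group)
     \<and> discrete_in_PGL4R (case_prod klein_holonomy complete_point ` carrier fig8_group)
     \<and> (\<exists>p. arc p \<and> path_image p \<subseteq> gluing_solutions \<and> pathstart p = complete_point)"
proof (intro conjI)
  show "\<forall>z1 z2. Im z1 > 0 \<and> Im z2 > 0 \<and> gluing_equations z1 z2 \<longrightarrow>
        holonomy z1 z2 \<in> hom fig8_group PSL2C \<and>
        (\<forall>s. holonomy z1 z2 (fig8_gen s) = psl_class (rho_matrix z1 z2 s)) \<and>
        pgl_class (klein_matrix z1 z2 GX) \<in> carrier PSO31 \<and>
        represents (pgl_class (klein_matrix z1 z2 GX)) (holonomy z1 z2 (fig8_gen GX)) \<and>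
        pgl_class (klein_matrix z1 z2 GY) \<in> carrier PSO31 \<and>
        represents (pgl_class (klein_matrix z1 z2 GY)) (holonomy z1 z2 (fig8_gen GY)) \<and>
        klein_holonomy z1 z2 \<in> hom fig8_group PSO31 \<and>
        (\<forall>s. klein_holonomy z1 z2 (fig8_gen s) = pgl_class (klein_matrix z1 z2 s)) \<and>
        (\<forall>\<gamma>\<in>carrier fig8_group. represents (klein_holonomy z1 z2 \<gamma>) (holonomy z1 z2 \<gamma>))"
  proof (intro allI impI)
    fix z1 z2 assume "Im z1 > 0 \<and> Im z2 > 0 \<and> gluing_equations z1 z2"
    then have sol: "(z1, z2) \<in> gluing_solutions" by (simp add: gluing_solutions_def)
    note props = representation_properties[OF sol]
    have "fig8_gen s \<in> carrier fig8_group" for s by (simp add: fig8_gen_def carrier_fig8_group)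
    then have "represents (pgl_class (klein_matrix z1 z2 s)) (holonomy z1 z2 (fig8_gen s))" for s
      using props(4)[of "fig8_gen s"] by (simp add: props(2))
    then show "holonomy z1 z2 \<in> hom fig8_group PSL2C \<and>
        (\<forall>s. holonomy z1 z2 (fig8_gen s) = psl_class (rho_matrix z1 z2 s)) \<and>
        pgl_class (klein_matrix z1 z2 GX) \<in> carrier PSO31 \<and>
        represents (pgl_class (klein_matrix z1 z2 GX)) (holonomy z1 z2 (fig8_gen GX)) \<and>
        pgl_class (klein_matrix z1 z2 GY) \<in> carrier PSO31 \<and>
        represents (pgl_class (klein_matrix z1 z2 GY)) (holonomy z1 z2 (fig8_gen GY)) \<and>
        klein_holonomy z1 z2 \<in> hom fig8_group PSO31 \<and>
        (\<forall>s. klein_holonomy z1 z2 (fig8_gen s) = pgl_class (klein_matrix z1 z2 s)) \<and>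
        (\<forall>\<gamma>\<in>carrier fig8_group. represents (klein_holonomy z1 z2 \<gamma>) (holonomy z1 z2 \<gamma>))"
      using props holonomy_hom(1)[OF sol] klein_holonomy_hom_PSO31[OF sol] by blast
  qed
  show "\<forall>s i j. rational_function_on gluing_solutions (\<lambda>(z1, z2). klein_matrix z1 z2 s $ i $ j)"
    using rational_klein_matrix by blast
  show "\<forall>\<gamma>\<in>carrier fig8_group. continuous_map (top_of_set gluing_solutions) PGL4R_topology
            (\<lambda>(z1, z2). klein_holonomy z1 z2 \<gamma>)"
    using continuous_klein_holonomy by blast
qed (simp_all add: complete_point_eq omega_solution inj_klein_holonomy_omega
    discrete_klein_holonomy_omega exists_arc[unfolded complete_point_eq])

end
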